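(* Let $\Phi=(G,\varphi)$ be a complex unit gain graph and let $C_p^{\varphi}$ be a pendant cycle of $\Phi$ of order $p$, with $v$ the unique vertex of $C_p$ of degree $3$ in $G$. Let $F^{\varphi}=(F,\varphi)=\Phi-C_p^{\varphi}$ (delete all vertices of $C_p$) and $H^{\varphi}=(H,\varphi)=F^{\varphi}+v$ (the induced subgraph on $V(F)\cup\{v\}$). If $r(\Phi)=r(G)+2\theta(G)$, then (a) $C_p^{\varphi}$ is of Type B with $p\equiv 0\pmod 4$; (b) $r(H^{\varphi})=r(H)+2\theta(H)$ and $r(F^{\varphi})=r(F)+2\theta(F)$; (c) $r(\Phi)=p+r(F^{\varphi})$, $r(F^{\varphi})=r(H^{\varphi})$, $r(G)=p-2+r(H)$ and $r(F)=r(H)$.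
   Context: A complex unit gain graph $\Phi=(G,\varphi)$ consists of a finite simple graph $G$ with vertex set $\{v_1,\dots,v_n\}$ and a gain function $\varphi$ assigning to each oriented edge $e_{ij}$ ($v_iv_j\in E(G)$) a complex number of modulus $1$ with $\varphi(e_{ji})=\overline{\varphi(e_{ij})}$. $A(\Phi)$ is the Hermitian matrix with $(i,j)$ entry $\varphi(e_{ij})$ if $v_iv_j\in E(G)$ and $0$ otherwise; $r(\Phi)$ is its rank; $r(\cdot)$ of a simple graph is the rank of its $0$-$1$ adjacency matrix. Induced subgraphs of $\Phi$ carry the gains of $\Phi$. $\theta(G)=|E(G)|-|V(G)|+\omega(G)$, $\omega(G)$ the number of components. A pendant cycle of $G$ is an induced subgraph $C_p$ that is a cycle and has a unique vertex of degree $3$ in $G$ (its other vertices having degree $2$ in $G$). For a gain cycle with vertices $v_1,\dots,v_p$ in cyclic order, $\varphi(C_p)=\varphi(e_{12})\cdots\varphi(e_{p1})$; for $p$ even it is of Type B if $\varphi(C_p)\neq(-1)^{p/2}$. *)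

theory Defs
  imports Complex_Main "Jordan_Normal_Form.DL_Rank"
begin

text \<open>A (finite simple) graph is given by a finite vertex set V and a symmetric,
irreflexive edge relation E; only edges between vertices of V are considered.
An induced subgraph on S \<subseteq> V is represented by the same relation E
restricted to S. A complex unit gain graph additionally carries a gain
function phi on oriented edges.\<close>

definition simple_graph :: "'a set \<Rightarrow> ('a \<Rightarrow> 'a \<Rightarrow> bool) \<Rightarrow> bool" where
  "simple_graph V E \<longleftrightarrow> finite V \<and> (\<forall>u v. E u v \<longrightarrow> E v u) \<and> (\<forall>u. \<not> E u u)"

definition unit_gain :: "'a set \<Rightarrow> ('a \<Rightarrow> 'a \<Rightarrow> bool) \<Rightarrow> ('a \<Rightarrow> 'a \<Rightarrow> complex) \<Rightarrow> bool" where
  "unit_gain V E phi \<longleftrightarrow> (\<forall>u\<in>V. \<forall>v\<in>V. E u v \<longrightarrow> cmod (phi u v) = 1 \<and> phi v u = cnj (phi u v))"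

definition gain_graph :: "'a set \<Rightarrow> ('a \<Rightarrow> 'a \<Rightarrow> bool) \<Rightarrow> ('a \<Rightarrow> 'a \<Rightarrow> complex) \<Rightarrow> bool" where
  "gain_graph V E phi \<longleftrightarrow> simple_graph V E \<and> unit_gain V E phi"

text \<open>Vertices are listed in increasing order to build matrices
(the rank does not depend on the ordering).\<close>

definition gain_adj :: "('a::linorder) set \<Rightarrow> ('a \<Rightarrow> 'a \<Rightarrow> bool) \<Rightarrow> ('a \<Rightarrow> 'a \<Rightarrow> complex) \<Rightarrow> complex mat" where
  "gain_adj V E phi = (let vs = sorted_list_of_set V in
     mat (card V) (card V) (\<lambda>(i,j). if E (vs ! i) (vs ! j) then phi (vs ! i) (vs ! j) else 0))"

definition adj :: "('a::linorder) set \<Rightarrow> ('a \<Rightarrow> 'a \<Rightarrow> bool) \<Rightarrow> real mat" where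
  "adj V E = (let vs = sorted_list_of_set V in
     mat (card V) (card V) (\<lambda>(i,j). if E (vs ! i) (vs ! j) then 1 else 0))"

definition gain_rank :: "('a::linorder) set \<Rightarrow> ('a \<Rightarrow> 'a \<Rightarrow> bool) \<Rightarrow> ('a \<Rightarrow> 'a \<Rightarrow> complex) \<Rightarrow> nat" where
  "gain_rank V E phi = vec_space.rank (card V) (gain_adj V E phi)"

definition graph_rank :: "('a::linorder) set \<Rightarrow> ('a \<Rightarrow> 'a \<Rightarrow> bool) \<Rightarrow> nat" where
  "graph_rank V E = vec_space.rank (card V) (adj V E)"

definition num_edges :: "'a set \<Rightarrow> ('a \<Rightarrow> 'a \<Rightarrow> bool) \<Rightarrow> nat" where
  "num_edges V E = card {{u, v} | u v. u \<in> V \<and> v \<in> V \<and> E u v}"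

definition num_components :: "'a set \<Rightarrow> ('a \<Rightarrow> 'a \<Rightarrow> bool) \<Rightarrow> nat" where
  "num_components V E =
     card (V // {(x, y). x \<in> V \<and> y \<in> V \<and> (\<lambda>a b. a \<in> V \<and> b \<in> V \<and> E a b)\<^sup>*\<^sup>* x y})"

definition cyclomatic :: "'a set \<Rightarrow> ('a \<Rightarrow> 'a \<Rightarrow> bool) \<Rightarrow> int" where
  "cyclomatic V E = int (num_edges V E) - int (card V) + int (num_components V E)"

definition degree :: "'a set \<Rightarrow> ('a \<Rightarrow> 'a \<Rightarrow> bool) \<Rightarrow> 'a \<Rightarrow> nat" where
  "degree V E v = card {u \<in> V. E v u}"

definition induced_cycle :: "'a set \<Rightarrow> ('a \<Rightarrow> 'a \<Rightarrow> bool) \<Rightarrow> 'a list \<Rightarrow> bool" where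
  "induced_cycle V E cs \<longleftrightarrow> distinct cs \<and> length cs \<ge> 3 \<and> set cs \<subseteq> V \<and>
     (\<forall>i<length cs. \<forall>j<length cs.
        E (cs ! i) (cs ! j) \<longleftrightarrow> (j = (i + 1) mod length cs \<or> i = (j + 1) mod length cs))"

definition pendant_cycle :: "'a set \<Rightarrow> ('a \<Rightarrow> 'a \<Rightarrow> bool) \<Rightarrow> 'a list \<Rightarrow> 'a \<Rightarrow> bool" where
  "pendant_cycle V E cs v \<longleftrightarrow> induced_cycle V E cs \<and> v \<in> set cs \<and> degree V E v = 3 \<and>
     (\<forall>u\<in>set cs. u \<noteq> v \<longrightarrow> degree V E u = 2)"

definition cycle_gain :: "('a \<Rightarrow> 'a \<Rightarrow> complex) \<Rightarrow> 'a list \<Rightarrow> complex" where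
  "cycle_gain phi cs = (\<Prod>i<length cs. phi (cs ! i) (cs ! ((i + 1) mod length cs)))"

definition type_B :: "('a \<Rightarrow> 'a \<Rightarrow> complex) \<Rightarrow> 'a list \<Rightarrow> bool" where
  "type_B phi cs \<longleftrightarrow> even (length cs) \<and> cycle_gain phi cs \<noteq> (-1) ^ (length cs div 2)"

end

theory Submission
  imports Defs
begin

text \<open>
  Two reductions carry the argument. First, eliminating two adjacent vertices \<open>x, y\<close> of a path
  \<open>s, x, y, z\<close> lowers the rank of the (weighted) adjacency matrix by \<open>2\<close> and leaves an edge \<open>s z\<close>
  whose weight is minus the gain of the path. Iterating this along the pendant cycle gives, for
  even \<open>p\<close>, rank \<open>p + r(F)\<close> if the gain of the cycle differs from \<open>(-1)\<close> to the power \<open>p/2\<close>, and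
  \<open>p - 2 + r(H)\<close> otherwise; for odd \<open>p\<close> it gives \<open>p - 1\<close> plus the rank of \<open>H\<close> with a modified
  diagonal entry at \<open>v\<close>. This applies to the gain graph and to the underlying graph alike.

  Second, \<open>r(\<Phi>) \<le> r(G) + 2 \<theta>(G)\<close> always: a diagonal rescaling makes all gains but those of
  \<open>\<theta>(G)\<close> edges equal to \<open>1\<close>, and each remaining edge changes the rank by at most \<open>2\<close>. Applied to
  \<open>F\<close> and \<open>H\<close>, whose cyclomatic numbers are smaller than that of \<open>G\<close>, this bound excludes every
  case except \<open>4\<close> dividing \<open>p\<close> and the cycle being of Type B, where all inequalities are equalities.
\<close>

section \<open>Rank as the length of a shortest factorisation\<close>

text \<open>A sum of \<open>k\<close> rank-one matrices. Indexing by arbitrary sets avoids any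
  vertex order, and separate \<open>R\<close> and \<open>C\<close> allow a pivot to remove a row and
  a column with different labels.\<close>

definition factors_through :: "nat \<Rightarrow> 'a set \<Rightarrow> 'b set \<Rightarrow> ('a \<Rightarrow> 'b \<Rightarrow> 'k::field) \<Rightarrow> bool" where
  "factors_through k R C A \<longleftrightarrow>
     (\<exists>b c. \<forall>x\<in>R. \<forall>y\<in>C. A x y = (\<Sum>i<k. b i x * c i y))"

definition frank :: "'a set \<Rightarrow> 'b set \<Rightarrow> ('a \<Rightarrow> 'b \<Rightarrow> 'k::field) \<Rightarrow> nat" where
  "frank R C A = (LEAST k. factors_through k R C A)"

lemma factors_throughI:
  assumes "finite J" and "\<And>x y. x \<in> R \<Longrightarrow> y \<in> C \<Longrightarrow> A x y = (\<Sum>j\<in>J. b j x * c j y)"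
  shows "factors_through (card J) R C A"
proof -
  obtain h where h: "bij_betw h {0..<card J} J"
    using ex_bij_betw_nat_finite[OF assms(1)] by blast
  have "A x y = (\<Sum>i<card J. b (h i) x * c (h i) y)" if "x \<in> R" "y \<in> C" for x y
    using assms(2)[OF that] sum.reindex_bij_betw[OF h, of "\<lambda>j. b j x * c j y"]
    by (simp add: atLeast0LessThan)
  then show ?thesis
    unfolding factors_through_def by (intro exI[of _ "\<lambda>i. b (h i)"] exI[of _ "\<lambda>i. c (h i)"]) blast
qed

lemma factors_through_Suc:
  assumes "factors_through k R C A"
    and "\<And>x y. x \<in> R \<Longrightarrow> y \<in> C \<Longrightarrow> B x y = A x y + f x * g y"
  shows "factors_through (Suc k) R C B"
proof -
  obtain b c where bc: "\<And>x y. x \<in> R \<Longrightarrow> y \<in> C \<Longrightarrow> A x y = (\<Sum>i<k. b i x * c i y)"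
    using assms(1) unfolding factors_through_def by blast
  have "B x y = (\<Sum>i<Suc k. (b(k := f)) i x * (c(k := g)) i y)" if "x \<in> R" "y \<in> C" for x y
    using assms(2)[OF that] bc[OF that] by simp
  then show ?thesis unfolding factors_through_def by blast
qed

lemma factors_through_frank:
  assumes "finite R"
  shows "factors_through (frank R C A) R C A"
proof -
  have "factors_through (card R) R C A"
    by (rule factors_throughI[OF assms, where b = "\<lambda>j x. if x = j then 1 else 0" and c = A])
      (use assms in \<open>simp add: if_distrib[of "\<lambda>t. t * _"] cong: if_cong\<close>)
  then show ?thesis unfolding frank_def by (rule LeastI)
qed

lemma frank_le: "factors_through k R C A \<Longrightarrow> frank R C A \<le> k"
  unfolding frank_def by (rule Least_le)

text \<open>A factorisation of \<open>A'\<close> pulls back along any reindexing \<open>f\<close>,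
  \<open>g\<close> and any scaling \<open>u\<close>, \<open>w\<close>. This covers submatrices,
  renumbering of vertices and switching.\<close>

lemma frank_transfer:
  assumes "finite R'"
    and "\<And>x. x \<in> R \<Longrightarrow> f x \<in> R'" and "\<And>y. y \<in> C \<Longrightarrow> g y \<in> C'"
    and "\<And>x y. x \<in> R \<Longrightarrow> y \<in> C \<Longrightarrow> A x y = u x * A' (f x) (g y) * w y"
  shows "frank R C A \<le> frank R' C' A'"
proof -
  define k where "k = frank R' C' A'"
  obtain b c where bc: "\<And>x y. x \<in> R' \<Longrightarrow> y \<in> C' \<Longrightarrow> A' x y = (\<Sum>i<k. b i x * c i y)"
    using factors_through_frank[OF assms(1), of C' A'] unfolding factors_through_def k_def by blast
  have "A x y = (\<Sum>i<k. (u x * b i (f x)) * (c i (g y) * w y))" if "x \<in> R" "y \<in> C" for x y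
    unfolding assms(4)[OF that] bc[OF assms(2)[OF that(1)] assms(3)[OF that(2)]]
    by (simp add: sum_distrib_left sum_distrib_right mult.assoc)
  then have "factors_through k R C A"
    unfolding factors_through_def
    by (intro exI[of _ "\<lambda>i x. u x * b i (f x)"] exI[of _ "\<lambda>i y. c i (g y) * w y"]) blast
  then show ?thesis unfolding k_def by (rule frank_le)
qed

lemma frank_mono:
  assumes "finite R'" "R \<subseteq> R'" "C \<subseteq> C'"
  shows "frank R C A \<le> frank R' C' A"
  by (rule frank_transfer[where f = "\<lambda>x. x" and g = "\<lambda>x. x" and u = "\<lambda>_. 1" and w = "\<lambda>_. 1"])
    (use assms in auto)

lemma frank_cong:
  assumes "\<And>x y. x \<in> R \<Longrightarrow> y \<in> C \<Longrightarrow> A x y = A' x y"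
  shows "frank R C A = frank R C A'"
  using assms unfolding frank_def factors_through_def by simp

lemma frank_zero: "(\<And>x y. x \<in> R \<Longrightarrow> y \<in> C \<Longrightarrow> A x y = 0) \<Longrightarrow> frank R C A = 0"
  using frank_le[of 0 R C A] by (simp add: factors_through_def)

lemma frank_add_rank1:
  assumes "finite R" and "\<And>x y. x \<in> R \<Longrightarrow> y \<in> C \<Longrightarrow> B x y = A x y + f x * g y"
  shows "frank R C B \<le> Suc (frank R C A)"
  by (rule frank_le[OF factors_through_Suc[OF factors_through_frank[OF assms(1)] assms(2)]])

lemma frank_upd_entry:
  assumes "finite R" and "\<And>x y. x \<in> R \<Longrightarrow> y \<in> C \<Longrightarrow> (x, y) \<noteq> (a, b) \<Longrightarrow> B x y = A x y"
  shows "frank R C B \<le> Suc (frank R C A)"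
  by (rule frank_add_rank1[OF assms(1), where f = "\<lambda>x. if x = a then B a b - A a b else 0"
        and g = "\<lambda>y. if y = b then 1 else 0"])
    (use assms(2) in auto)

lemma frank_insert_zero:
  assumes "finite R" and "\<And>y. y \<in> insert b C \<Longrightarrow> A a y = 0" and "\<And>x. x \<in> insert a R \<Longrightarrow> A x b = 0"
  shows "frank (insert a R) (insert b C) A = frank R C A"
proof (rule antisym)
  show "frank R C A \<le> frank (insert a R) (insert b C) A"
    by (rule frank_mono) (use assms in auto)
  define k where "k = frank R C A"
  obtain f g where fg: "\<And>x y. x \<in> R \<Longrightarrow> y \<in> C \<Longrightarrow> A x y = (\<Sum>i<k. f i x * g i y)"
    using factors_through_frank[OF assms(1), of C A] unfolding factors_through_def k_def by blast
  have "factors_through k (insert a R) (insert b C) A"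
    unfolding factors_through_def
  proof (intro exI ballI)
    fix x y assume "x \<in> insert a R" "y \<in> insert b C"
    then show "A x y = (\<Sum>i<k. (if x = a then 0 else f i x) * (if y = b then 0 else g i y))"
    proof (cases "x = a \<or> y = b")
      case True
      then have "A x y = 0" using assms(2,3) \<open>x \<in> _\<close> \<open>y \<in> _\<close> by blast
      then show ?thesis using True by (auto simp: sum.neutral)
    next
      case False
      then show ?thesis using fg \<open>x \<in> _\<close> \<open>y \<in> _\<close> by auto
    qed
  qed
  then show "frank (insert a R) (insert b C) A \<le> frank R C A" unfolding k_def by (rule frank_le)
qed

lemma frank_insert_row:
  assumes "finite R"
  shows "frank (insert a R) C A \<le> Suc (frank R C A)"
proof -
  define k where "k = frank R C A"
  obtain f g where fg: "\<And>x y. x \<in> R \<Longrightarrow> y \<in> C \<Longrightarrow> A x y = (\<Sum>i<k. f i x * g i y)"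
    using factors_through_frank[OF assms(1), of C A] unfolding factors_through_def k_def by blast
  let ?A0 = "\<lambda>x y. if x = a then 0 else A x y"
  have "factors_through k (insert a R) C ?A0"
    unfolding factors_through_def
    by (intro exI[of _ "\<lambda>i x. if x = a then 0 else f i x"] exI[of _ g]) (use fg in auto)
  then have "factors_through (Suc k) (insert a R) C A"
    by (rule factors_through_Suc[where f = "\<lambda>x. if x = a then 1 else 0" and g = "A a"]) auto
  then show ?thesis unfolding k_def by (rule frank_le)
qed

lemma frank_insert_col:
  assumes "finite R"
  shows "frank R (insert b C) A \<le> Suc (frank R C A)"
proof -
  define k where "k = frank R C A"
  obtain f g where fg: "\<And>x y. x \<in> R \<Longrightarrow> y \<in> C \<Longrightarrow> A x y = (\<Sum>i<k. f i x * g i y)"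
    using factors_through_frank[OF assms(1), of C A] unfolding factors_through_def k_def by blast
  let ?A0 = "\<lambda>x y. if y = b then 0 else A x y"
  have "factors_through k R (insert b C) ?A0"
    unfolding factors_through_def
    by (intro exI[of _ f] exI[of _ "\<lambda>i x. if x = b then 0 else g i x"]) (use fg in auto)
  then have "factors_through (Suc k) R (insert b C) A"
    by (rule factors_through_Suc[where g = "\<lambda>x. if x = b then 1 else 0" and f = "\<lambda>x. A x b"]) auto
  then show ?thesis unfolding k_def by (rule frank_le)
qed

lemma frank_insert_both:
  assumes "finite R"
  shows "frank (insert a R) (insert b C) A \<le> frank R C A + 2"
  using frank_insert_row[OF assms, of a "insert b C" A] frank_insert_col[OF assms, of b C A] by simp

text \<open>Gaussian elimination at the entry \<open>A a b\<close>; the right side is the Schur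
  complement. For \<le>, adding one rank-one matrix to the complement restores \<open>A\<close>. For
  \<ge>, a shortest factorisation of \<open>A\<close> yields one of the complement in which a
  summand can be absorbed by the others.\<close>

lemma frank_pivot:
  fixes A :: "'a \<Rightarrow> 'b \<Rightarrow> 'k::field"
  assumes "finite R" and "A a b \<noteq> 0"
  shows "frank (insert a R) (insert b C) A = Suc (frank R C (\<lambda>x y. A x y - A x b * A a y / A a b))"
    (is "_ = Suc (frank R C ?S)")
proof (rule antisym)
  have "frank (insert a R) (insert b C) ?S = frank R C ?S"
    by (rule frank_insert_zero) (use assms in auto)
  moreover have "frank (insert a R) (insert b C) A \<le> Suc (frank (insert a R) (insert b C) ?S)"
    by (rule frank_add_rank1[where f = "\<lambda>x. A x b" and g = "\<lambda>y. A a y / A a b"]) (use assms in auto)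
  ultimately show "frank (insert a R) (insert b C) A \<le> Suc (frank R C ?S)" by simp
next
  define k where "k = frank (insert a R) (insert b C) A"
  obtain f g where fg: "\<And>x y. x \<in> insert a R \<Longrightarrow> y \<in> insert b C \<Longrightarrow> A x y = (\<Sum>i<k. f i x * g i y)"
    using factors_through_frank[of "insert a R" "insert b C" A] assms(1)
    unfolding factors_through_def k_def by blast
  have "(\<Sum>i<k. f i a * g i b) \<noteq> 0" using fg[of a b] assms(2) by simp
  then obtain j where j: "j < k" "f j a \<noteq> 0"
    by (metis (no_types, lifting) lessThan_iff mult_zero_left sum.not_neutral_contains_not_neutral)
  \<comment> \<open>Correcting the right factors alone subtracts
    \<open>A x b * A a y / A a b\<close>, since \<open>A x b\<close> is itself the sum of all
    \<open>f i x * g i b\<close>.\<close>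
  define z where "z i y = g i y - g i b * A a y / A a b" for i y
  have S: "?S x y = (\<Sum>i<k. f i x * z i y)" if "x \<in> insert a R" "y \<in> insert b C" for x y
    using fg[OF that] fg[of x b] that unfolding z_def
    by (simp add: right_diff_distrib sum_subtractf sum_distrib_right sum_divide_distrib mult.assoc)
  have rem: "(\<Sum>i<k. h i) = h j + (\<Sum>i\<in>{..<k} - {j}. h i)" for h :: "nat \<Rightarrow> 'k"
    using j by (intro sum.remove) auto
  \<comment> \<open>Row a of the Schur complement vanishes, so the j-th summand is a combination of the others.\<close>
  have zj: "z j y = - (\<Sum>i\<in>{..<k} - {j}. f i a * z i y) / f j a" if "y \<in> insert b C" for y
  proof -
    have "(\<Sum>i<k. f i a * z i y) = 0" using S[of a y] that assms(2) by simp
    then have "f j a * z j y = - (\<Sum>i\<in>{..<k} - {j}. f i a * z i y)"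
      unfolding rem by (simp add: eq_neg_iff_add_eq_0)
    then show ?thesis using j(2) by (metis nonzero_mult_div_cancel_left)
  qed
  have "factors_through (card ({..<k} - {j})) R C ?S"
  proof (rule factors_throughI[where b = "\<lambda>i x. f i x - f j x * f i a / f j a" and c = z])
    fix x y assume xy: "x \<in> R" "y \<in> C"
    have "?S x y = f j x * z j y + (\<Sum>i\<in>{..<k} - {j}. f i x * z i y)"
      using S[of x y] xy unfolding rem by simp
    also have "\<dots> = (\<Sum>i\<in>{..<k} - {j}. (f i x - f j x * f i a / f j a) * z i y)"
      using zj[of y] xy
      by (simp add: left_diff_distrib sum_subtractf sum_distrib_left sum_divide_distrib mult.assoc)
    finally show "?S x y = (\<Sum>i\<in>{..<k} - {j}. (f i x - f j x * f i a / f j a) * z i y)" .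
  qed simp
  then have "frank R C ?S \<le> k - 1" using frank_le[of "card ({..<k} - {j})" R C ?S] j by simp
  then show "Suc (frank R C ?S) \<le> frank (insert a R) (insert b C) A"
    using j unfolding k_def by linarith
qed

section \<open>Agreement with the rank of a matrix\<close>

lemma (in vec_space) rank_le_factors_through:
  assumes "factors_through k {..<n} {..<nc} A"
  shows "rank (mat n nc (\<lambda>(i, j). A i j)) \<le> k"
  using assms
proof (induction k arbitrary: A)
  case 0
  then have "mat n nc (\<lambda>(i, j). A i j) = 0\<^sub>m n nc"
    by (intro eq_matI) (auto simp: factors_through_def)
  then show ?case by (simp add: rank_0I)
next
  case (Suc k)
  then obtain b c where bc: "\<And>i j. i < n \<Longrightarrow> j < nc \<Longrightarrow> A i j = (\<Sum>l<Suc k. b l i * c l j)"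
    unfolding factors_through_def by blast
  define B where "B i j = (\<Sum>l<k. b l i * c l j)" for i j
  let ?P = "mat n nc (\<lambda>(i, j). b k i * c k j)"
  have "mat n nc (\<lambda>(i, j). A i j) = mat n nc (\<lambda>(i, j). B i j) + ?P"
    by (intro eq_matI) (auto simp: bc B_def)
  then have "rank (mat n nc (\<lambda>(i, j). A i j)) \<le> rank (mat n nc (\<lambda>(i, j). B i j)) + rank ?P"
    using rank_subadditive[of "mat n nc (\<lambda>(i, j). B i j)" nc ?P] by simp
  moreover have "rank (mat n nc (\<lambda>(i, j). B i j)) \<le> k"
    by (rule Suc.IH) (auto simp: factors_through_def B_def)
  moreover have "rank ?P \<le> 1"
    by (rule rank_le_1_product_entries[where f = "b k" and g = "c k" and nc = nc]) auto
  ultimately show ?case by linarith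
qed

text \<open>A maximal independent set \<open>U\<close> of columns spans every column; the
  coefficients of the columns with respect to \<open>U\<close> give a factorisation with
  \<open>card U\<close> summands.\<close>

lemma (in vec_space) factors_through_rank:
  "factors_through (rank (mat n nc (\<lambda>(i, j). A i j))) {..<n} {..<nc} A"
proof -
  let ?M = "mat n nc (\<lambda>(i, j). A i j)"
  let ?P = "\<lambda>T. T \<subseteq> set (cols ?M) \<and> lin_indpt T"
  have carr: "set (cols ?M) \<subseteq> carrier_vec n"
    using cols_dim[of ?M] by simp
  have "lin_indpt {}" by (simp add: lin_dep_def)
  then obtain U where U: "maximal U ?P" "finite U"
    using maximal_exists_superset[of "set (cols ?M)" ?P "{}"] by auto
  then have Usub: "U \<subseteq> set (cols ?M)" and Uli: "lin_indpt U" by (auto simp: maximal_def)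
  have Uc: "U \<subseteq> carrier_vec n" using Usub carr by blast
  have rk: "rank ?M = card U" by (rule rank_card_indpt[OF _ U(1)]) auto
  have span: "x \<in> span U" if "x \<in> set (cols ?M)" for x
  proof (rule ccontr)
    assume x: "x \<notin> span U"
    then have "lin_indpt (U \<union> {x})"
      using that carr Uc Uli lindep_span lin_dep_iff_in_span span_mem by (meson subsetD)
    then have "?P (U \<union> {x})" using that Usub by auto
    then have "x \<in> U" using U(1) unfolding maximal_def by blast
    then show False using x span_mem[OF Uc] by blast
  qed
  have "\<exists>a. col ?M j = lincomb a U" if "j < nc" for j
  proof -
    have "col ?M j \<in> set (cols ?M)" using that by (simp add: cols_def)
    from finite_in_span[OF U(2) Uc span[OF this]] obtain a where "lincomb a U = col ?M j"
      by (elim exE conjE)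
    then show ?thesis by (intro exI[of _ a]) simp
  qed
  then obtain a where a: "\<And>j. j < nc \<Longrightarrow> col ?M j = lincomb (a j) U" by metis
  have "A i j = (\<Sum>u\<in>U. u $ i * a j u)" if "i < n" "j < nc" for i j
  proof -
    have "A i j = col ?M j $ i" using that by simp
    also have "\<dots> = (\<Sum>u\<in>U. a j u * u $ i)"
      unfolding a[OF that(2)] by (rule lincomb_index[OF that(1) Uc])
    finally show ?thesis by (simp add: mult.commute)
  qed
  then show ?thesis unfolding rk
    by (intro factors_throughI[OF U(2), where b = "\<lambda>u i. u $ i" and c = "\<lambda>u j. a j u"]) auto
qed

lemma (in vec_space) rank_eq_frank:
  "rank (mat n nc (\<lambda>(i, j). A i j)) = frank {..<n} {..<nc} A"
  by (rule antisym[OF rank_le_factors_through[OF factors_through_frank] frank_le[OF factors_through_rank]])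
    simp

text \<open>Replaces the matrices built from the sorted vertex list by functions on vertices, so
  that vertices can be deleted without renumbering.\<close>

lemma rank_sorted_eq_frank:
  assumes "finite V"
  shows "vec_space.rank (card V) (mat (card V) (card V)
      (\<lambda>(i, j). A (sorted_list_of_set V ! i) (sorted_list_of_set V ! j))) = frank V V A"
proof -
  let ?vs = "sorted_list_of_set V"
  have bij: "bij_betw ((!) ?vs) {..<card V} V"
    using assms by (intro bij_betw_nth) auto
  have inV: "?vs ! i \<in> V" if "i < card V" for i
    using bij that by (auto simp: bij_betw_def)
  define h where "h = the_inv_into {..<card V} ((!) ?vs)"
  have h: "h x < card V" "?vs ! h x = x" if "x \<in> V" for x
    using bij that f_the_inv_into_f_bij_betw[OF bij] the_inv_into_into[of "(!) ?vs" "{..<card V}" x "{..<card V}"]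
    by (auto simp: h_def bij_betw_def)
  have "frank {..<card V} {..<card V} (\<lambda>i j. A (?vs ! i) (?vs ! j)) = frank V V A"
  proof (rule antisym)
    show "frank {..<card V} {..<card V} (\<lambda>i j. A (?vs ! i) (?vs ! j)) \<le> frank V V A"
      by (rule frank_transfer[OF assms, where f = "(!) ?vs" and g = "(!) ?vs" and u = "\<lambda>_. 1" and w = "\<lambda>_. 1"])
        (use inV in auto)
    show "frank V V A \<le> frank {..<card V} {..<card V} (\<lambda>i j. A (?vs ! i) (?vs ! j))"
      by (rule frank_transfer[where f = h and g = h and u = "\<lambda>_. 1" and w = "\<lambda>_. 1"])
        (use h in auto)
  qed
  then show ?thesis
    using vec_space.rank_eq_frank[of "card V" "card V" "\<lambda>i j. A (?vs ! i) (?vs ! j)"] by simp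
qed

section \<open>Elimination along paths\<close>

text \<open>Two pivots, at \<open>(x, y)\<close> and then at \<open>(y, x)\<close>. Since the
  diagonal entries at \<open>x\<close> and \<open>y\<close> vanish, the first pivot leaves row
  \<open>y\<close> and column \<open>x\<close> unchanged, so the second pivot entry is still
  \<open>M y x\<close>.\<close>

lemma frank_eliminate_pair:
  assumes "finite U" and "M x x = 0" "M y y = 0" and "M x y \<noteq> 0" "M y x \<noteq> 0"
  shows "frank (insert x (insert y U)) (insert x (insert y U)) M =
    frank U U (\<lambda>u w. M u w - M u y * M x w / M x y - M u x * M y w / M y x) + 2"
proof -
  define S where "S = (\<lambda>u w. M u w - M u y * M x w / M x y)"
  have S: "S y w = M y w" "S u x = M u x" for u w using assms by (simp_all add: S_def)
  have "frank (insert x (insert y U)) (insert y (insert x U)) M = Suc (frank (insert y U) (insert x U) S)"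
    unfolding S_def by (rule frank_pivot) (use assms in auto)
  moreover have "frank (insert y U) (insert x U) S = Suc (frank U U (\<lambda>u w. S u w - S u x * S y w / S y x))"
    by (rule frank_pivot) (use assms S in auto)
  ultimately show ?thesis unfolding S by (simp add: S_def insert_commute)
qed

text \<open>One edge with reciprocal weights in its two directions; for weights of modulus 1 the
  reciprocal is the conjugate. If \<open>s = z\<close> the terms add up to a loop of weight
  \<open>a + 1 / a\<close>, which is what an odd cycle leaves behind.\<close>

definition edge_mat :: "'a \<Rightarrow> 'a \<Rightarrow> 'k::field \<Rightarrow> 'a \<Rightarrow> 'a \<Rightarrow> 'k" where
  "edge_mat s z a x y = (if x = s \<and> y = z then a else 0) + (if x = z \<and> y = s then 1 / a else 0)"

lemma edge_mat_outside: "x \<noteq> s \<Longrightarrow> x \<noteq> z \<Longrightarrow> edge_mat s z a x y = 0"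
  "y \<noteq> s \<Longrightarrow> y \<noteq> z \<Longrightarrow> edge_mat s z a x y = 0"
  by (auto simp: edge_mat_def)

text \<open>Eliminating \<open>x\<close> and \<open>y\<close> changes only the entries at
  \<open>(s, z)\<close> and \<open>(z, s)\<close>, by \<open>- (a * b * c)\<close> and by its
  reciprocal, so the outcome is again an edge matrix. \<open>B\<close> is the rest of the graph,
  which does not touch \<open>x\<close> or \<open>y\<close>.\<close>

lemma frank_contract_path:
  fixes B :: "'a \<Rightarrow> 'a \<Rightarrow> 'k::field"
  assumes "finite U" "x \<noteq> y" "x \<notin> U" "y \<notin> U" "s \<in> U" "z \<in> U"
    and "a \<noteq> 0" "b \<noteq> 0" "c \<noteq> 0"
    and B: "\<And>u. B u x = 0" "\<And>u. B x u = 0" "\<And>u. B u y = 0" "\<And>u. B y u = 0"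
  shows "frank (insert x (insert y U)) (insert x (insert y U))
      (\<lambda>u w. B u w + (edge_mat s x a u w + (edge_mat x y b u w + edge_mat y z c u w))) =
    frank U U (\<lambda>u w. B u w + edge_mat s z (- (a * b * c)) u w) + 2"
proof -
  let ?M = "\<lambda>u w. B u w + (edge_mat s x a u w + (edge_mat x y b u w + edge_mat y z c u w))"
  have ne: "s \<noteq> x" "s \<noteq> y" "z \<noteq> x" "z \<noteq> y" "y \<noteq> x" "x \<noteq> s" "y \<noteq> s" "x \<noteq> z" "y \<noteq> z"
    using assms by auto
  have M: "?M x x = 0" "?M y y = 0" "?M x y = b" "?M y x = 1 / b"
    using assms(2) ne B by (simp_all add: edge_mat_def)
  have "frank (insert x (insert y U)) (insert x (insert y U)) ?M =
    frank U U (\<lambda>u w. ?M u w - ?M u y * ?M x w / ?M x y - ?M u x * ?M y w / ?M y x) + 2"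
    by (rule frank_eliminate_pair) (use M assms in auto)
  also have "frank U U (\<lambda>u w. ?M u w - ?M u y * ?M x w / ?M x y - ?M u x * ?M y w / ?M y x) =
    frank U U (\<lambda>u w. B u w + edge_mat s z (- (a * b * c)) u w)"
  proof (rule frank_cong)
    fix u w assume uw: "u \<in> U" "w \<in> U"
    then have n: "u \<noteq> x" "u \<noteq> y" "w \<noteq> x" "w \<noteq> y" using assms by auto
    have e: "?M u w = B u w" "?M u y = (if u = z then 1 / c else 0)" "?M x w = (if w = s then 1 / a else 0)"
      "?M u x = (if u = s then a else 0)" "?M y w = (if w = z then c else 0)"
      using n ne assms(2) B by (auto simp: edge_mat_def)
    have t1: "(if u = z then 1 / c else 0) * (if w = s then 1 / a else 0) / b =
        (if u = z \<and> w = s then 1 / (a * b * c) else 0)"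
      by (auto simp: ac_simps)
    have t2: "(if u = s then a else 0) * (if w = z then c else 0) / (1 / b) =
        (if u = s \<and> w = z then a * b * c else 0)"
      by (auto simp: ac_simps)
    have "p - (if P then r else 0) - (if Q then q else 0) =
        p + ((if Q then - q else 0) + (if P then - r else 0))" for p q r :: 'k and P Q
      by simp
    moreover have "1 / - (a * b * c) = - (1 / (a * b * c))" by (rule minus_divide_right[symmetric])
    ultimately show "?M u w - ?M u y * ?M x w / ?M x y - ?M u x * ?M y w / ?M y x =
      B u w + edge_mat s z (- (a * b * c)) u w"
      by (simp only: e M t1 t2 edge_mat_def[of s z "- (a * b * c)" u w])
  qed
  finally show ?thesis .
qed

text \<open>Induction on \<open>m\<close>: contracting the last three edges into one removes two
  inner vertices, lowers the rank by 2 and contributes a sign. With an odd number of edges all inner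
  vertices disappear in pairs. The two ends may coincide, as they do for a whole cycle.\<close>

lemma frank_contract_ear:
  fixes a :: "nat \<Rightarrow> 'k::field"
  assumes "finite S" "c 0 \<in> S" "c (2 * m + 1) \<in> S"
    and "inj_on c {1..<2 * m + 1}" "c ` {1..<2 * m + 1} \<inter> S = {}"
    and "\<And>i. i < 2 * m + 1 \<Longrightarrow> a i \<noteq> 0"
    and "\<And>u w. u \<notin> S \<or> w \<notin> S \<Longrightarrow> B u w = 0"
  shows "frank (S \<union> c ` {1..<2 * m + 1}) (S \<union> c ` {1..<2 * m + 1})
      (\<lambda>u w. B u w + (\<Sum>i<2 * m + 1. edge_mat (c i) (c (i + 1)) (a i) u w)) =
    frank S S (\<lambda>u w. B u w + edge_mat (c 0) (c (2 * m + 1)) ((-1) ^ m * (\<Prod>i<2 * m + 1. a i)) u w) + 2 * m"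
  using assms
proof (induction m arbitrary: c a)
  case 0
  then show ?case by simp
next
  case (Suc m)
  let ?n = "2 * m"
  let ?x = "c (?n + 1)" and ?y = "c (?n + 2)" and ?z = "c (?n + 3)"
  define U where "U = S \<union> c ` {1..<?n + 1}"
  \<comment> \<open>\<open>B'\<close> absorbs the path edges before the last three. None of them
    touches \<open>?x\<close> or \<open>?y\<close>, so \<open>B'\<close> vanishes there and a
    contraction applies.\<close>
  define B' where "B' u w = B u w + (\<Sum>i<?n. edge_mat (c i) (c (i + 1)) (a i) u w)" for u w
  have inj: "c i = c j \<longleftrightarrow> i = j" if "i \<in> {1..<?n + 3}" "j \<in> {1..<?n + 3}" for i j
    using Suc.prems(4) that by (auto simp: inj_on_def)
  have out: "c i \<notin> S" if "i \<in> {1..<?n + 3}" for i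
    using Suc.prems(5) that by (auto simp: eval_nat_numeral disjoint_iff)
  have sU: "c ?n \<in> U" using Suc.prems(2) by (cases "m = 0") (auto simp: U_def)
  have zU: "?z \<in> U" using Suc.prems(3) by (simp add: U_def eval_nat_numeral)
  have xyU: "?x \<notin> U" "?y \<notin> U" "?x \<noteq> ?y"
    using inj out by (auto simp: U_def)
  have B': "B' u w = 0" if "u \<in> {?x, ?y} \<or> w \<in> {?x, ?y}" for u w
  proof -
    have "u \<notin> S \<or> w \<notin> S" using that out by auto
    moreover have "edge_mat (c i) (c (i + 1)) (a i) u w = 0" if "i < ?n" for i
    proof -
      have "t \<noteq> c i \<and> t \<noteq> c (i + 1)" if "t \<in> {?x, ?y}" for t
      proof -
        have tS: "t \<notin> S" using that out[of "?n + 1"] out[of "?n + 2"] by auto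
        show ?thesis
          using that \<open>i < ?n\<close> inj tS Suc.prems(2) by (cases "i = 0") auto
      qed
      then show ?thesis using \<open>u \<in> _ \<or> w \<in> _\<close> edge_mat_outside by metis
    qed
    ultimately show ?thesis unfolding B'_def using Suc.prems(7) by simp
  qed
  have split: "{..<2 * Suc m + 1} = insert (?n + 2) (insert (?n + 1) (insert ?n {..<?n}))" by auto
  have setU: "S \<union> c ` {1..<2 * Suc m + 1} = insert ?x (insert ?y U)"
  proof -
    have "{1..<2 * Suc m + 1} = insert (?n + 1) (insert (?n + 2) {1..<?n + 1})" by auto
    then show ?thesis unfolding U_def by auto
  qed
  have "frank (insert ?x (insert ?y U)) (insert ?x (insert ?y U))
      (\<lambda>u w. B u w + (\<Sum>i<2 * Suc m + 1. edge_mat (c i) (c (i + 1)) (a i) u w)) =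
    frank (insert ?x (insert ?y U)) (insert ?x (insert ?y U))
      (\<lambda>u w. B' u w + (edge_mat (c ?n) ?x (a ?n) u w + (edge_mat ?x ?y (a (?n + 1)) u w + edge_mat ?y ?z (a (?n + 2)) u w)))"
    unfolding B'_def by (rule frank_cong) (simp add: split eval_nat_numeral ac_simps)
  also have "\<dots> = frank U U (\<lambda>u w. B' u w + edge_mat (c ?n) ?z (- (a ?n * a (?n + 1) * a (?n + 2))) u w) + 2"
    by (rule frank_contract_path) (use Suc.prems(1,6) sU zU xyU B' in \<open>auto simp: U_def\<close>)
  finally have step: "frank (insert ?x (insert ?y U)) (insert ?x (insert ?y U))
      (\<lambda>u w. B u w + (\<Sum>i<2 * Suc m + 1. edge_mat (c i) (c (i + 1)) (a i) u w)) =
    frank U U (\<lambda>u w. B' u w + edge_mat (c ?n) ?z (- (a ?n * a (?n + 1) * a (?n + 2))) u w) + 2" .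
  \<comment> \<open>The shortened path ends at \<open>?z\<close>, moved to position
    \<open>2 * m + 1\<close>; its last edge carries the contracted weight.\<close>
  define c' where "c' = c(?n + 1 := ?z)"
  define a' where "a' = a(?n := - (a ?n * a (?n + 1) * a (?n + 2)))"
  have im: "c' ` {1..<?n + 1} = c ` {1..<?n + 1}" unfolding c'_def by auto
  have sum': "(\<Sum>i<?n + 1. edge_mat (c' i) (c' (i + 1)) (a' i) u w) =
      (\<Sum>i<?n. edge_mat (c i) (c (i + 1)) (a i) u w) + edge_mat (c ?n) ?z (- (a ?n * a (?n + 1) * a (?n + 2))) u w" for u w
    by (simp add: c'_def a'_def)
  have prod': "(-1) ^ m * (\<Prod>i<?n + 1. a' i) = (-1) ^ Suc m * (\<Prod>i<2 * Suc m + 1. a i)"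
    by (simp add: a'_def split ac_simps)
  have ends: "c' 0 = c 0" "c' (?n + 1) = c (2 * Suc m + 1)"
    by (auto simp: c'_def eval_nat_numeral)
  have "frank (S \<union> c' ` {1..<?n + 1}) (S \<union> c' ` {1..<?n + 1})
      (\<lambda>u w. B u w + (\<Sum>i<?n + 1. edge_mat (c' i) (c' (i + 1)) (a' i) u w)) =
    frank S S (\<lambda>u w. B u w + edge_mat (c' 0) (c' (?n + 1)) ((-1) ^ m * (\<Prod>i<?n + 1. a' i)) u w) + ?n"
  proof (rule Suc.IH)
    show "inj_on c' {1..<?n + 1}" using inj by (auto simp: inj_on_def c'_def)
    show "c' ` {1..<?n + 1} \<inter> S = {}" using out unfolding im by auto
    show "a' i \<noteq> 0" if "i < ?n + 1" for i using that Suc.prems(6) by (auto simp: a'_def)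
  qed (use Suc.prems ends in auto)
  then have "frank U U (\<lambda>u w. B' u w + edge_mat (c ?n) ?z (- (a ?n * a (?n + 1) * a (?n + 2))) u w) =
    frank S S (\<lambda>u w. B u w + edge_mat (c 0) (c (2 * Suc m + 1)) ((-1) ^ Suc m * (\<Prod>i<2 * Suc m + 1. a i)) u w) + ?n"
    unfolding sum' prod' im ends U_def B'_def by (simp add: add.assoc)
  then show ?case unfolding setU step by simp
qed

text \<open>Pivoting inside the block \<open>R \<times> C\<close> shifts the corner entries of \<open>A\<close> and \<open>B\<close> by the same
  amount, so one may assume that this block vanishes.\<close>

lemma frank_corner_independent:
  assumes "finite R" and "a \<notin> R" and "b \<notin> C"
    and "frank (insert a R) (insert b C) A = frank R C A + 2"
    and "\<And>x y. x \<in> insert a R \<Longrightarrow> y \<in> insert b C \<Longrightarrow> (x, y) \<noteq> (a, b) \<Longrightarrow> B x y = A x y"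
  shows "frank (insert a R) (insert b C) B = frank R C A + 2"
  using assms
proof (induction "card R" arbitrary: R C A B rule: less_induct)
  case less
  show ?case
  proof (cases "\<exists>x\<in>R. \<exists>y\<in>C. A x y \<noteq> 0")
    case True
    then obtain x y where xy: "x \<in> R" "y \<in> C" "A x y \<noteq> 0" by blast
    have Bxy: "B x y = A x y" using xy less.prems by auto
    let ?S = "\<lambda>M u w. M u w - M u y * M x w / M x y"
    let ?R = "R - {x}" and ?C = "C - {y}"
    have R: "insert x ?R = R" "insert x (insert a ?R) = insert a R" using xy by auto
    have C: "insert y ?C = C" "insert y (insert b ?C) = insert b C" using xy by auto
    have fin: "finite ?R" "finite (insert a ?R)" using less.prems(1) by auto
    have A1: "frank R C A = Suc (frank ?R ?C (?S A))"
      using frank_pivot[OF fin(1), of A x y ?C] xy unfolding R C by simp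
    have A2: "frank (insert a R) (insert b C) A = Suc (frank (insert a ?R) (insert b ?C) (?S A))"
      using frank_pivot[OF fin(2), of A x y "insert b ?C"] xy unfolding R C by simp
    have B2: "frank (insert a R) (insert b C) B = Suc (frank (insert a ?R) (insert b ?C) (?S B))"
      using frank_pivot[OF fin(2), of B x y "insert b ?C"] xy Bxy unfolding R C by simp
    have "frank (insert a ?R) (insert b ?C) (?S B) = frank ?R ?C (?S A) + 2"
    proof (rule less.hyps)
      show "card ?R < card R" using xy less.prems(1) by (meson card_Diff1_less)
      show "frank (insert a ?R) (insert b ?C) (?S A) = frank ?R ?C (?S A) + 2"
        using A1 A2 less.prems(4) by simp
      fix u w assume uw: "u \<in> insert a ?R" "w \<in> insert b ?C" "(u, w) \<noteq> (a, b)"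
      have "B u w = A u w" "B u y = A u y" "B x w = A x w"
        using uw xy less.prems by auto
      then show "?S B u w = ?S A u w" using Bxy by simp
    qed (use less.prems in auto)
    then show ?thesis using A1 B2 by simp
  next
    case False
    then have z: "A x y = 0" if "x \<in> R" "y \<in> C" for x y using that by blast
    have r0: "frank R C A = 0" by (rule frank_zero) (use z in auto)
    \<comment> \<open>Row \<open>a\<close> raises the rank by at most one, so a total of 2 needs a
      nonzero entry of column \<open>b\<close> within \<open>R\<close>, and symmetrically one of row
      \<open>a\<close> within \<open>C\<close>.\<close>
    have Rb: "frank R (insert b C) A \<noteq> 0"
      using frank_insert_row[OF less.prems(1), of a "insert b C" A] less.prems(4) r0 by auto
    have "\<exists>x\<in>R. A x b \<noteq> 0"
    proof (rule ccontr)
      assume "\<not> ?thesis"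
      then have "frank R (insert b C) A = 0" by (intro frank_zero) (use z in auto)
      then show False using Rb by simp
    qed
    then obtain x where x: "x \<in> R" "A x b \<noteq> 0" by blast
    have Ca: "frank (insert a R) C A \<noteq> 0"
      using frank_insert_col[of "insert a R" b C A] less.prems(1,4) r0 by auto
    have "\<exists>y\<in>C. A a y \<noteq> 0"
    proof (rule ccontr)
      assume "\<not> ?thesis"
      then have "frank (insert a R) C A = 0" by (intro frank_zero) (use z in auto)
      then show False using Ca by simp
    qed
    then obtain y where y: "y \<in> C" "A a y \<noteq> 0" by blast
    have Beq: "B a y = A a y" "B x b = A x b" "B x y = A x y"
      using x y less.prems by auto
    \<comment> \<open>The minor on rows \<open>a\<close>, \<open>x\<close> and columns
      \<open>y\<close>, \<open>b\<close> is zero at \<open>(x, y)\<close> and nonzero at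
      \<open>(a, y)\<close> and \<open>(x, b)\<close>, so it has rank 2 whatever
      \<open>B a b\<close> is.\<close>
    let ?S = "\<lambda>u w. B u w - B u y * B a w / B a y"
    have "Suc (Suc 0) \<le> Suc (frank {x} {b} ?S)"
      using frank_pivot[of "{}" ?S x b "{}"] Beq z[of x y] x y by simp
    also have "\<dots> = frank {a, x} {y, b} B"
      using frank_pivot[of "{x}" B a y "{b}"] Beq y by simp
    also have "\<dots> \<le> frank (insert a R) (insert b C) B"
      by (rule frank_mono) (use less.prems(1) x y in auto)
    finally have "frank (insert a R) (insert b C) B \<ge> 2" by simp
    moreover have "frank (insert a R) (insert b C) B \<le> frank R C B + 2"
      by (rule frank_insert_both[OF less.prems(1)])
    moreover have "frank R C B = frank R C A"
      by (rule frank_cong) (use less.prems in auto)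
    ultimately show ?thesis using r0 by simp
  qed
qed

text \<open>Each pair \<open>{a, b}\<close> covers the two entries \<open>(a, b)\<close> and
  \<open>(b, a)\<close>, and changing one entry raises the rank by at most one.\<close>

lemma frank_change_pairs:
  assumes "finite K" and "finite V"
    and "\<And>x y. x \<in> V \<Longrightarrow> y \<in> V \<Longrightarrow> A x y \<noteq> B x y \<Longrightarrow> {x, y} \<in> K"
    and "\<And>e. e \<in> K \<Longrightarrow> \<exists>x y. e = {x, y}"
  shows "frank V V A \<le> frank V V B + 2 * card K"
  using assms(1,3,4)
proof (induction K arbitrary: A rule: finite_induct)
  case empty
  then have "frank V V A = frank V V B" by (intro frank_cong) auto
  then show ?case by simp
next
  case (insert e K)
  obtain a b where e: "e = {a, b}" using insert.prems(2)[of e] by auto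
  define A1 where "A1 x y = (if (x, y) = (a, b) then B x y else A x y)" for x y
  define A2 where "A2 x y = (if (x, y) = (b, a) then B x y else A1 x y)" for x y
  have "frank V V A \<le> Suc (frank V V A1)"
    by (rule frank_upd_entry[OF assms(2), where a = a and b = b]) (auto simp: A1_def)
  also have "frank V V A1 \<le> Suc (frank V V A2)"
    by (rule frank_upd_entry[OF assms(2), where a = b and b = a]) (auto simp: A2_def)
  also have "frank V V A2 \<le> frank V V B + 2 * card K"
  proof (rule insert.IH)
    fix x y assume xy: "x \<in> V" "y \<in> V" "A2 x y \<noteq> B x y"
    then have "A x y \<noteq> B x y" "(x, y) \<noteq> (a, b)" "(x, y) \<noteq> (b, a)"
      by (auto simp: A2_def A1_def split: if_splits)
    then show "{x, y} \<in> K" using insert.prems(1)[of x y] xy e by (auto simp: doubleton_eq_iff)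
  qed (use insert.prems(2) in auto)
  finally show ?case using insert.hyps by simp
qed

section \<open>Cyclomatic number and switching\<close>

definition reachable :: "'a set \<Rightarrow> ('a \<Rightarrow> 'a \<Rightarrow> bool) \<Rightarrow> 'a \<Rightarrow> 'a \<Rightarrow> bool" where
  "reachable V E = (\<lambda>a b. a \<in> V \<and> b \<in> V \<and> E a b)\<^sup>*\<^sup>*"

definition component_rel :: "'a set \<Rightarrow> ('a \<Rightarrow> 'a \<Rightarrow> bool) \<Rightarrow> ('a \<times> 'a) set" where
  "component_rel V E = {(x, y). x \<in> V \<and> y \<in> V \<and> reachable V E x y}"

lemma num_components_eq: "num_components V E = card (V // component_rel V E)"
  by (simp add: num_components_def component_rel_def reachable_def)

lemma reachable_refl [simp]: "reachable V E x x"
  by (simp add: reachable_def)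

lemma reachable_edge: "x \<in> V \<Longrightarrow> y \<in> V \<Longrightarrow> E x y \<Longrightarrow> reachable V E x y"
  unfolding reachable_def by (rule r_into_rtranclp) simp

lemma reachable_trans: "reachable V E x y \<Longrightarrow> reachable V E y z \<Longrightarrow> reachable V E x z"
  unfolding reachable_def by (rule rtranclp_trans)

lemma reachable_sym:
  assumes "\<And>x y. E x y \<Longrightarrow> E y x" and "reachable V E x y"
  shows "reachable V E y x"
proof -
  have "symp (\<lambda>a b. a \<in> V \<and> b \<in> V \<and> E a b)" using assms(1) by (auto simp: symp_def)
  from sympD[OF symp_rtranclp[OF this]] show ?thesis using assms(2) unfolding reachable_def by blast
qed

lemma equiv_component_rel:
  assumes "\<And>x y. E x y \<Longrightarrow> E y x"
  shows "equiv V (component_rel V E)"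
proof (rule equivI)
  show "component_rel V E \<subseteq> V \<times> V" by (auto simp: component_rel_def)
  show "refl_on V (component_rel V E)" by (auto simp: component_rel_def refl_on_def)
  show "sym (component_rel V E)"
    using reachable_sym[of E V] assms by (auto simp: component_rel_def sym_def)
  show "trans (component_rel V E)"
    by (auto simp: component_rel_def trans_def intro: reachable_trans)
qed

text \<open>\<open>f\<close> is applied to one representative per class; reflecting the relations
  makes the induced map on classes injective. \<open>Q\<close> leaves room for excluding a
  class.\<close>

lemma card_classes_le:
  assumes r: "equiv A r" and s: "equiv B s" and "finite B" and Q: "Q \<subseteq> A // r"
    and f: "\<And>x. x \<in> A \<Longrightarrow> f x \<in> B"
    and refl: "\<And>x y. x \<in> \<Union>Q \<Longrightarrow> y \<in> \<Union>Q \<Longrightarrow> (f x, f y) \<in> s \<Longrightarrow> (x, y) \<in> r"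
  shows "card Q \<le> card (B // s)"
proof (rule card_inj_on_le)
  define rep where "rep C = (SOME x. x \<in> C)" for C :: "'a set"
  have rep: "rep C \<in> C" if "C \<in> Q" for C
    using that Q in_quotient_imp_non_empty[OF r] by (metis rep_def some_in_eq subsetD)
  have repA: "rep C \<in> A" if "C \<in> Q" for C
    using rep[OF that] that Q in_quotient_imp_subset[OF r] by blast
  show "inj_on (\<lambda>C. s `` {f (rep C)}) Q"
  proof (rule inj_onI)
    fix C D assume CD: "C \<in> Q" "D \<in> Q" "s `` {f (rep C)} = s `` {f (rep D)}"
    then have "(f (rep C), f (rep D)) \<in> s"
      using eq_equiv_class[OF _ s] f repA by blast
    then have "(rep C, rep D) \<in> r" using refl CD rep by blast
    then show "C = D"
      using quotient_eqI[OF r] CD Q rep by blast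
  qed
  show "(\<lambda>C. s `` {f (rep C)}) ` Q \<subseteq> B // s"
    using f repA by (auto intro: quotientI)
  show "finite (B // s)"
    using \<open>finite B\<close> s by (meson equiv_type finite_quotient)
qed

definition edges :: "'a set \<Rightarrow> ('a \<Rightarrow> 'a \<Rightarrow> bool) \<Rightarrow> 'a set set" where
  "edges V E = {{u, v} | u v. u \<in> V \<and> v \<in> V \<and> E u v}"

lemma num_edges_eq: "num_edges V E = card (edges V E)"
  by (simp add: num_edges_def edges_def)

lemma finite_edges: "finite V \<Longrightarrow> finite (edges V E)"
  by (rule finite_subset[of _ "Pow V"]) (auto simp: edges_def)

text \<open>\<open>f\<close> maps walks between vertices of \<open>V'\<close> to walks inside
  \<open>V'\<close>, so passing from \<open>V'\<close> to \<open>V\<close> merges no components. The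
  remaining difference is the count of edges in \<open>L\<close> and of vertices outside
  \<open>V'\<close>.\<close>

lemma cyclomatic_retract:
  assumes "finite V" and sym: "\<And>x y. E x y \<Longrightarrow> E y x" and "V' \<subseteq> V"
    and f: "\<And>x. x \<in> V \<Longrightarrow> f x \<in> V'" "\<And>x. x \<in> V' \<Longrightarrow> f x = x"
    and edge: "\<And>x y. x \<in> V \<Longrightarrow> y \<in> V \<Longrightarrow> E x y \<Longrightarrow> f x = f y \<or> E (f x) (f y)"
    and L: "L \<subseteq> edges V E" "L \<inter> edges V' E = {}"
  shows "cyclomatic V' E + int (card L) - int (card (V - V')) \<le> cyclomatic V E"
proof -
  have "reachable V' E (f x) (f y)" if "x \<in> V" "reachable V E x y" for x y
    using that(2,1) unfolding reachable_def
  proof (induction rule: rtranclp_induct)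
    case (step y z)
    then have "(\<lambda>a b. a \<in> V' \<and> b \<in> V' \<and> E a b)\<^sup>*\<^sup>* (f y) (f z)"
      using reachable_edge[of "f y" V' "f z" E] edge[of y z] f by (auto simp: reachable_def)
    then show ?case using step by (meson rtranclp_trans)
  qed simp
  then have reach: "reachable V' E x y" if "x \<in> V'" "y \<in> V'" "reachable V E x y" for x y
    using that f assms(3) by (metis subsetD)
  have "num_components V' E \<le> num_components V E"
    unfolding num_components_eq
    by (rule card_classes_le[OF equiv_component_rel equiv_component_rel \<open>finite V\<close> order_refl, where f = "\<lambda>x. x"])
      (use sym assms(3) reach in \<open>auto simp: component_rel_def quotient_def\<close>)
  moreover have "card (edges V' E) + card L \<le> card (edges V E)"
  proof -
    have "edges V' E \<union> L \<subseteq> edges V E" using L(1) assms(3) by (auto simp: edges_def)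
    then have "card (edges V' E \<union> L) \<le> card (edges V E)" by (intro card_mono finite_edges assms(1))
    moreover have "finite L" "finite (edges V' E)"
      using finite_edges assms(1,3) L(1) finite_subset by metis+
    ultimately show ?thesis using L(2) by (simp add: card_Un_disjoint Int_commute)
  qed
  moreover have "card V = card V' + card (V - V')"
    using assms(1,3) by (metis card_Un_disjoint Diff_disjoint Diff_partition finite_Diff finite_subset)
  ultimately show ?thesis unfolding cyclomatic_def num_edges_eq by linarith
qed

text \<open>Invariant along a walk: its current vertex is reached directly or by one passage of the
  extra edge; a passage back cancels the first.\<close>

lemma reachable_add_edge:
  assumes "\<And>x y. E' x y \<Longrightarrow> E x y \<or> (x = u \<and> y = w) \<or> (x = w \<and> y = u)"
    and "reachable V E' x y"
  shows "reachable V E x y \<or> reachable V E x u \<and> reachable V E w y \<or> reachable V E x w \<and> reachable V E u y"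
  using assms(2) unfolding reachable_def[of V E']
proof (induction rule: rtranclp_induct)
  case (step y z)
  have "reachable V E y z \<or> (y = u \<and> z = w) \<or> (y = w \<and> z = u)"
    using step.hyps(2) assms(1)[of y z] reachable_edge[of y V z E] by blast
  then show ?case
    using step.IH reachable_trans[of V E x y z] reachable_trans[of V E w y z]
      reachable_trans[of V E u y z] by auto
qed simp

text \<open>The extra edge can merge only the classes of \<open>u\<close> and \<open>w\<close>. Once
  the class of \<open>u\<close> is set aside, \<open>E'\<close> connects no two different remaining
  classes. If \<open>u\<close> and \<open>w\<close> are already connected, nothing new is connected
  at all.\<close>

lemma num_components_add_edge:
  assumes "finite V" and sym: "\<And>x y. E x y \<Longrightarrow> E y x" "\<And>x y. E' x y \<Longrightarrow> E' y x"
    and "u \<in> V" "w \<in> V"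
    and E': "\<And>x y. E' x y \<Longrightarrow> E x y \<or> (x = u \<and> y = w) \<or> (x = w \<and> y = u)"
  shows "num_components V E \<le> num_components V E' + 1"
    and "reachable V E u w \<Longrightarrow> num_components V E \<le> num_components V E'"
proof -
  let ?r = "component_rel V E" and ?s = "component_rel V E'"
  let ?Q = "V // ?r - {?r `` {u}}"
  have eqs: "equiv V ?r" "equiv V ?s" using equiv_component_rel sym by blast+
  have "card ?Q \<le> card (V // ?s)"
  proof (rule card_classes_le[OF eqs \<open>finite V\<close>, where f = "\<lambda>x. x"])
    fix x y assume xy: "x \<in> \<Union>?Q" "y \<in> \<Union>?Q" "(x, y) \<in> ?s"
    \<comment> \<open>Rules out both alternatives of \<open>reachable_add_edge\<close> that pass
      through \<open>u\<close>.\<close>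
    have nu: "\<not> reachable V E t u" "\<not> reachable V E u t" if tQ: "t \<in> \<Union>?Q" for t
    proof -
      obtain C where C: "C \<in> V // ?r" "C \<noteq> ?r `` {u}" "t \<in> C" using tQ by blast
      have "(u, t) \<notin> ?r"
      proof
        assume ut: "(u, t) \<in> ?r"
        have "C = ?r `` {t}" using C(1,3) by (metis Image_singleton_iff eqs(1) equiv_class_eq_iff quotientE)
        also have "\<dots> = ?r `` {u}" using equiv_class_eq[OF eqs(1) ut] by simp
        finally show False using C(2) by simp
      qed
      moreover have "t \<in> V" using C(1,3) in_quotient_imp_subset[OF eqs(1)] by blast
      ultimately show "\<not> reachable V E u t" using \<open>u \<in> V\<close> by (simp add: component_rel_def)
      then show "\<not> reachable V E t u" using reachable_sym[of E V t u] sym(1) by blast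
    qed
    have "x \<in> V" "y \<in> V" "reachable V E' x y" using xy(3) by (auto simp: component_rel_def)
    then show "(x, y) \<in> ?r"
      using reachable_add_edge[OF E'] nu xy(1,2) unfolding component_rel_def by blast
  qed auto
  moreover have "card (V // ?r) \<le> card ?Q + 1"
    using card_Diff_singleton_if[of "V // ?r" "?r `` {u}"] by (auto split: if_splits)
  ultimately show "num_components V E \<le> num_components V E' + 1"
    unfolding num_components_eq by simp
  assume uw: "reachable V E u w"
  then have wu: "reachable V E w u" using reachable_sym[of E V u w] sym(1) by blast
  have "reachable V E x y" if "reachable V E' x y" for x y
    using reachable_add_edge[OF E' that] uw wu reachable_trans by metis
  then show "num_components V E \<le> num_components V E'"
    unfolding num_components_eq
    by (intro card_classes_le[OF eqs \<open>finite V\<close> order_refl, where f = "\<lambda>x. x"])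
      (auto simp: component_rel_def)
qed

text \<open>Induction on the edges: one that closes a cycle goes into \<open>K\<close> and is paid
  for by the cyclomatic number, while a bridge is made neutral by adapting \<open>d\<close>. In
  effect \<open>K\<close> is the complement of a spanning forest.\<close>

lemma switching_exists:
  fixes phi :: "'a \<Rightarrow> 'a \<Rightarrow> 'k::field"
  assumes "finite V" and "\<And>x y. E x y \<Longrightarrow> E y x" and "\<And>x. \<not> E x x"
    and "\<And>x y. x \<in> V \<Longrightarrow> y \<in> V \<Longrightarrow> E x y \<Longrightarrow> phi x y * phi y x = 1"
  shows "\<exists>d K. (\<forall>x. d x \<noteq> 0) \<and> K \<subseteq> edges V E \<and> int (card K) \<le> cyclomatic V E \<and>
    (\<forall>x\<in>V. \<forall>y\<in>V. E x y \<longrightarrow> {x, y} \<notin> K \<longrightarrow> d x * phi x y = d y)"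
  using assms(2-4)
proof (induction "num_edges V E" arbitrary: E rule: less_induct)
  case less
  show ?case
  proof (cases "\<exists>u\<in>V. \<exists>w\<in>V. E u w")
    case False
    have reach: "x = y" if "reachable V E x y" for x y
      using that unfolding reachable_def
      by (induction rule: rtranclp_induct) (use False in auto)
    \<comment> \<open>Without edges every vertex is its own component, so the cyclomatic number is
      not negative and the empty \<open>K\<close> qualifies.\<close>
    have "card V \<le> num_components V E"
      unfolding num_components_eq
    proof (rule card_inj_on_le[where f = "\<lambda>x. component_rel V E `` {x}"])
      show "inj_on (\<lambda>x. component_rel V E `` {x}) V"
      proof (rule inj_onI)
        fix x y assume "x \<in> V" "y \<in> V" "component_rel V E `` {x} = component_rel V E `` {y}"
        then have "y \<in> component_rel V E `` {x}" by (auto simp: component_rel_def)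
        then show "x = y" using reach by (auto simp: component_rel_def)
      qed
      show "finite (V // component_rel V E)"
        using assms(1) by (intro finite_quotient) (auto simp: component_rel_def)
    qed (auto intro: quotientI)
    then have "0 \<le> cyclomatic V E" unfolding cyclomatic_def by linarith
    then show ?thesis using False by (intro exI[of _ "\<lambda>_. 1"] exI[of _ "{}"]) auto
  next
    case True
    then obtain u w where uw: "u \<in> V" "w \<in> V" "E u w" by blast
    define E' where "E' x y \<longleftrightarrow> E x y \<and> {x, y} \<noteq> {u, w}" for x y
    have E'sym: "E' x y \<Longrightarrow> E' y x" for x y
      using less.prems(1) by (auto simp: E'_def insert_commute)
    have edges: "edges V E = insert {u, w} (edges V E')" "{u, w} \<notin> edges V E'"
      using uw less.prems(1) by (auto simp: edges_def E'_def) blast+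
    have ne: "num_edges V E = Suc (num_edges V E')"
      unfolding num_edges_eq edges(1) using edges(2) finite_edges[OF assms(1)] by simp
    have EE': "E x y \<Longrightarrow> E' x y \<or> (x = u \<and> y = w) \<or> (x = w \<and> y = u)" for x y
      by (auto simp: E'_def doubleton_eq_iff)
    have comp1: "num_components V E' \<le> num_components V E + 1"
      by (rule num_components_add_edge(1)[of V E' E u w]) (use assms(1) E'sym less.prems(1) uw EE' in blast)+
    have comp2: "num_components V E' \<le> num_components V E" if "reachable V E' u w"
      by (rule num_components_add_edge(2)[of V E' E u w]) (use that assms(1) E'sym less.prems(1) uw EE' in blast)+
    have "\<exists>d K. (\<forall>x. d x \<noteq> 0) \<and> K \<subseteq> edges V E' \<and> int (card K) \<le> cyclomatic V E' \<and>
        (\<forall>x\<in>V. \<forall>y\<in>V. E' x y \<longrightarrow> {x, y} \<notin> K \<longrightarrow> d x * phi x y = d y)"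
      by (rule less.hyps) (use ne E'sym less.prems in \<open>auto simp: E'_def\<close>)
    then obtain d K where d: "\<And>x. d x \<noteq> 0" and K: "K \<subseteq> edges V E'" "int (card K) \<le> cyclomatic V E'"
      and good: "\<And>x y. x \<in> V \<Longrightarrow> y \<in> V \<Longrightarrow> E' x y \<Longrightarrow> {x, y} \<notin> K \<Longrightarrow> d x * phi x y = d y"
      by blast
    have finK: "finite K" using K(1) finite_edges[OF assms(1)] finite_subset by blast
    have KE: "K \<subseteq> edges V E" using K(1) edges by auto
    show ?thesis
    proof (cases "reachable V E' u w")
      case True
      have "cyclomatic V E' + 1 \<le> cyclomatic V E"
        using comp2[OF True] ne unfolding cyclomatic_def by linarith
      then have "int (card (insert {u, w} K)) \<le> cyclomatic V E"
        using K(2) card_insert_le_m1[of "card K + 1" K "{u, w}"] by simp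
      moreover have "d x * phi x y = d y" if "x \<in> V" "y \<in> V" "E x y" "{x, y} \<notin> insert {u, w} K" for x y
        using good that by (auto simp: E'_def)
      ultimately show ?thesis
        using d KE edges(1) by (intro exI[of _ d] exI[of _ "insert {u, w} K"]) auto
    next
      case False
      have "cyclomatic V E' \<le> cyclomatic V E"
        using comp1 ne unfolding cyclomatic_def by linarith
      then have card: "int (card K) \<le> cyclomatic V E" using K(2) by simp
      define t where "t = d w / (d u * phi u w)"
      have phi: "phi u w * phi w u = 1" using less.prems(3) uw by blast
      have phi0: "phi u w \<noteq> 0" using phi by auto
      have t0: "t \<noteq> 0" using d phi0 by (simp add: t_def)
      \<comment> \<open>Rescaling the component of u makes the bridge uw neutral and changes no other edge.\<close>
      define d' where "d' x = (if reachable V E' u x then t * d x else d x)" for x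
      have "d' x * phi x y = d' y" if xy: "x \<in> V" "y \<in> V" "E x y" "{x, y} \<notin> K" for x y
      proof (cases "E' x y")
        case True
        have "reachable V E' u x \<longleftrightarrow> reachable V E' u y"
          using reachable_trans[of V E' u x y] reachable_trans[of V E' u y x]
            reachable_edge[of x V y E'] reachable_edge[of y V x E'] xy True E'sym by blast
        then show ?thesis using good[OF xy(1,2) True xy(4)] by (simp add: d'_def mult.assoc)
      next
        case no: False
        have d'u: "d' u = t * d u" and d'w: "d' w = d w" using False by (simp_all add: d'_def)
        have fwd: "d' u * phi u w = d' w" unfolding d'u d'w t_def using d phi0 by simp
        have "d' w * phi w u = d' u * (phi u w * phi w u)" by (simp add: fwd[symmetric] mult.assoc)
        then have bwd: "d' w * phi w u = d' u" using phi by simp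
        show ?thesis using no EE'[OF xy(3)] fwd bwd by blast
      qed
      moreover have "d' x \<noteq> 0" for x using d t0 by (simp add: d'_def)
      ultimately show ?thesis using card KE by (intro exI[of _ d'] exI[of _ K]) auto
    qed
  qed
qed

section \<open>Pendant cycles\<close>

text \<open>The cycle is a closed sequence with \<open>c p = c 0\<close>, so successors need no
  modulus. \<open>c 0\<close> is the vertex of attachment; the inner vertices \<open>c 1\<close> to
  \<open>c (p - 1)\<close> form an ear with both ends at \<open>c 0\<close>.\<close>

locale ear_cycle =
  fixes V :: "'a set" and c :: "nat \<Rightarrow> 'a" and p :: nat
  assumes finV: "finite V" and p3: "p \<ge> 3" and closed: "c p = c 0"
    and inj: "inj_on c {..<p}" and sub: "c ` {..<p} \<subseteq> V"
begin

definition H where "H = V - c ` {1..<p}"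
definition F where "F = V - c ` {..<p}"

lemma c_eq_iff: "i < p \<Longrightarrow> j < p \<Longrightarrow> c i = c j \<longleftrightarrow> i = j"
  using inj by (auto simp: inj_on_def)

lemma c_Suc_eq_iff: "i < p \<Longrightarrow> 1 \<le> j \<Longrightarrow> j < p \<Longrightarrow> c (i + 1) = c j \<longleftrightarrow> i = j - 1"
  using c_eq_iff[of "i + 1" j] c_eq_iff[of 0 j] closed by (cases "i + 1 = p") auto

lemma c_Suc_neq_pred: "1 \<le> j \<Longrightarrow> j < p \<Longrightarrow> c (j + 1) \<noteq> c (j - 1)"
  using c_eq_iff[of "j + 1" "j - 1"] c_eq_iff[of 0 "j - 1"] closed p3 by (cases "j + 1 = p") auto

lemma cV: "i \<le> p \<Longrightarrow> c i \<in> V"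
  using sub closed p3 by (cases "i = p") auto

lemma c_in_H_iff: "i \<le> p \<Longrightarrow> c i \<in> H \<longleftrightarrow> i = 0 \<or> i = p"
proof -
  assume i: "i \<le> p"
  have "c 0 \<notin> c ` {1..<p}" using c_eq_iff[of 0] p3 by fastforce
  then have "c 0 \<in> H" using cV[of 0] by (simp add: H_def)
  moreover have "c i \<notin> H" if "i \<noteq> 0" "i \<noteq> p" using that i by (simp add: H_def)
  ultimately show ?thesis using closed by metis
qed

lemma H_eq: "H = insert (c 0) F" and cF: "c 0 \<notin> F"
proof -
  have "{..<p} = insert 0 {1..<p}" using p3 by auto
  then show "H = insert (c 0) F" using c_in_H_iff[of 0] by (auto simp: F_def H_def)
  show "c 0 \<notin> F" using p3 by (auto simp: F_def)
qed

lemma H_union: "H \<union> c ` {1..<p} = V"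
  using cV by (auto simp: H_def)

lemma finite_parts: "finite H" "finite F"
  using finV by (auto simp: H_def F_def)

end

section \<open>Ranks of matrices with a cycle attached at one vertex\<close>

locale ear_cycle_matrix = ear_cycle V c p for V :: "'a set" and c p +
  fixes M :: "'a \<Rightarrow> 'a \<Rightarrow> 'k::field"
  assumes unit: "\<And>i. i < p \<Longrightarrow> M (c i) (c (i + 1)) * M (c (i + 1)) (c i) = 1"
    and sparse: "\<And>j w. 1 \<le> j \<Longrightarrow> j < p \<Longrightarrow> w \<in> V \<Longrightarrow> w \<noteq> c (j + 1) \<Longrightarrow> w \<noteq> c (j - 1) \<Longrightarrow>
      M (c j) w = 0 \<and> M w (c j) = 0"
begin

definition wt where "wt i = M (c i) (c (i + 1))"

definition B where "B u w = (if u \<in> H \<and> w \<in> H then M u w else 0)"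

lemma wt_nonzero: "i < p \<Longrightarrow> wt i \<noteq> 0"
  using unit[of i] by (auto simp: wt_def)

lemma inverse_wt: "i < p \<Longrightarrow> 1 / wt i = M (c (i + 1)) (c i)"
  using unit[of i] wt_nonzero[of i] by (simp add: wt_def field_simps)

text \<open>Row and column of an inner vertex \<open>c j\<close> meet the sum only through its two
  cycle edges, numbered \<open>j\<close> and \<open>j - 1\<close>. Inside \<open>H\<close> the sum
  vanishes, as every cycle edge has an inner vertex.\<close>

lemma matrix_decomposition:
  assumes "u \<in> V" "w \<in> V"
  shows "M u w = B u w + (\<Sum>i<p. edge_mat (c i) (c (i + 1)) (wt i) u w)"
proof -
  have sum_delta: "(\<Sum>i<p. if i = j then h i else 0) = h j" if "j < p" for j and h :: "nat \<Rightarrow> 'k"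
    using that by simp
  have sum_edge: "(\<Sum>i<p. edge_mat (c i) (c (i + 1)) (wt i) u w) =
      (\<Sum>i<p. if u = c i \<and> w = c (i + 1) then wt i else 0) +
      (\<Sum>i<p. if u = c (i + 1) \<and> w = c i then 1 / wt i else 0)"
    by (simp add: edge_mat_def sum.distrib)
  have off: "\<exists>j. 1 \<le> j \<and> j < p \<and> x = c j" if "x \<in> V" "x \<notin> H" for x
    using that by (auto simp: H_def)
  consider (inner) "u \<in> H" "w \<in> H" | (left) j where "1 \<le> j" "j < p" "u = c j"
    | (right) j where "1 \<le> j" "j < p" "w = c j"
    using assms off by blast
  then show ?thesis
  proof cases
    case inner
    have "edge_mat (c i) (c (i + 1)) (wt i) u w = 0" if "i < p" for i
    proof (cases "i = 0")
      case True
      have "c 1 \<notin> H" using c_in_H_iff[of 1] p3 by simp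
      then have "u \<noteq> c 1" "w \<noteq> c 1" using inner by auto
      then show ?thesis using True by (simp add: edge_mat_def)
    next
      case False
      have "c i \<notin> H" using c_in_H_iff[of i] that False by simp
      then have "u \<noteq> c i" "w \<noteq> c i" using inner by auto
      then show ?thesis by (simp add: edge_mat_def)
    qed
    then show ?thesis using inner by (simp add: B_def)
  next
    case left
    have "u \<notin> H" using c_in_H_iff[of j] left by auto
    then have B0: "B u w = 0" by (simp add: B_def)
    have "(\<Sum>i<p. if u = c i \<and> w = c (i + 1) then wt i else 0) =
        (\<Sum>i<p. if i = j then (if w = c (j + 1) then wt j else 0) else 0)"
      by (rule sum.cong) (use left c_eq_iff in auto)
    then have s1: "(\<Sum>i<p. if u = c i \<and> w = c (i + 1) then wt i else 0) = (if w = c (j + 1) then wt j else 0)"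
      using sum_delta[of j] left by simp
    have "(\<Sum>i<p. if u = c (i + 1) \<and> w = c i then 1 / wt i else 0) =
        (\<Sum>i<p. if i = j - 1 then (if w = c (j - 1) then 1 / wt (j - 1) else 0) else 0)"
    proof (rule sum.cong)
      fix i assume "i \<in> {..<p}"
      then show "(if u = c (i + 1) \<and> w = c i then 1 / wt i else 0) =
          (if i = j - 1 then if w = c (j - 1) then 1 / wt (j - 1) else 0 else 0)"
        using c_Suc_eq_iff[of i j] left by (cases "i = j - 1") auto
    qed simp
    then have s2: "(\<Sum>i<p. if u = c (i + 1) \<and> w = c i then 1 / wt i else 0) =
        (if w = c (j - 1) then 1 / wt (j - 1) else 0)"
      using left by (simp add: less_imp_diff_less)
    have "1 / wt (j - 1) = M (c j) (c (j - 1))" using inverse_wt[of "j - 1"] left by simp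
    then show ?thesis
      unfolding B0 sum_edge s1 s2
      using left sparse[of j w] c_Suc_neq_pred[of j] assms by (auto simp: wt_def)
  next
    case right
    have "w \<notin> H" using c_in_H_iff[of j] right by auto
    then have B0: "B u w = 0" by (simp add: B_def)
    have "(\<Sum>i<p. if u = c (i + 1) \<and> w = c i then 1 / wt i else 0) =
        (\<Sum>i<p. if i = j then (if u = c (j + 1) then 1 / wt j else 0) else 0)"
      by (rule sum.cong) (use right c_eq_iff in auto)
    then have s1: "(\<Sum>i<p. if u = c (i + 1) \<and> w = c i then 1 / wt i else 0) = (if u = c (j + 1) then 1 / wt j else 0)"
      using sum_delta[of j] right by simp
    have "(\<Sum>i<p. if u = c i \<and> w = c (i + 1) then wt i else 0) =
        (\<Sum>i<p. if i = j - 1 then (if u = c (j - 1) then wt (j - 1) else 0) else 0)"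
    proof (rule sum.cong)
      fix i assume "i \<in> {..<p}"
      then show "(if u = c i \<and> w = c (i + 1) then wt i else 0) =
          (if i = j - 1 then if u = c (j - 1) then wt (j - 1) else 0 else 0)"
        using c_Suc_eq_iff[of i j] right by (cases "i = j - 1") auto
    qed simp
    then have s2: "(\<Sum>i<p. if u = c i \<and> w = c (i + 1) then wt i else 0) =
        (if u = c (j - 1) then wt (j - 1) else 0)"
      using right by (simp add: less_imp_diff_less)
    have "1 / wt j = M (c (j + 1)) (c j)" "wt (j - 1) = M (c (j - 1)) (c j)"
      using inverse_wt[of j] right by (simp_all add: wt_def)
    then show ?thesis
      unfolding B0 sum_edge s1 s2
      using right sparse[of j u] c_Suc_neq_pred[of j] assms by auto
  qed
qed

text \<open>The whole cycle is an ear with an odd number of edges. Contracting it leaves a loop at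
  \<open>c 0\<close> whose weight \<open>e\<close> is the contracted weight plus its
  reciprocal.\<close>

lemma frank_odd_cycle:
  assumes "p = 2 * m + 1"
  obtains e where "frank V V M = frank H H (\<lambda>u w. M u w + (if u = c 0 \<and> w = c 0 then e else 0)) + 2 * m"
proof -
  let ?q = "(-1) ^ m * (\<Prod>i<p. wt i)"
  have "frank V V M = frank V V (\<lambda>u w. B u w + (\<Sum>i<p. edge_mat (c i) (c (i + 1)) (wt i) u w))"
    by (rule frank_cong) (use matrix_decomposition in auto)
  also have "\<dots> = frank H H (\<lambda>u w. B u w + edge_mat (c 0) (c p) ?q u w) + 2 * m"
  proof (rule frank_contract_ear[of H c m wt B, folded assms, unfolded H_union])
    show "inj_on c {1..<p}" using inj by (auto simp: inj_on_def)
    show "c ` {1..<p} \<inter> H = {}" by (auto simp: H_def)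
  qed (use finite_parts c_in_H_iff[of 0] closed wt_nonzero B_def in auto)
  also have "frank H H (\<lambda>u w. B u w + edge_mat (c 0) (c p) ?q u w) =
      frank H H (\<lambda>u w. M u w + (if u = c 0 \<and> w = c 0 then ?q + 1 / ?q else 0))"
    by (rule frank_cong) (use closed in \<open>auto simp: B_def edge_mat_def\<close>)
  finally show ?thesis by (rule that)
qed

text \<open>All edges but the last are contracted, which leaves a double edge between
  \<open>v\<close> and \<open>t\<close>, the last vertex of the cycle. If its two weights cancel,
  \<open>t\<close> is isolated and \<open>H\<close> is left; otherwise \<open>t\<close> and
  \<open>v\<close> are eliminated together and \<open>F\<close> is left.\<close>

lemma frank_even_cycle:
  assumes p: "p = 2 * m + 2" and loop: "M (c 0) (c 0) = 0"
  shows "frank V V M = (if (\<Prod>i<p. M (c i) (c (i + 1))) = (-1) ^ (m + 1)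
    then frank H H M + 2 * m else frank F F M + 2 * m + 2)"
proof -
  define n where "n = 2 * m + 1"
  have n: "1 \<le> n" "n < p" "p \<le> n + 1" using p by (auto simp: n_def)
  have "p = n + 1" using n by simp
  then have cn: "c (n + 1) = c 0" using closed by simp
  have range: "{..<p} = insert n {..<n}" "{1..<p} = insert n {1..<n}" using n by auto
  define t v where "t = c n" and "v = c 0"
  define q where "q = (-1) ^ m * (\<Prod>i<n. wt i)"
  \<comment> \<open>The closing edge counts as background; the ear to be contracted runs from
    \<open>v\<close> to \<open>t\<close>.\<close>
  define B2 where "B2 u w = B u w + edge_mat t v (wt n) u w" for u w
  define N where "N u w = B2 u w + edge_mat v t q u w" for u w
  have tH: "t \<notin> H" and vH: "v \<in> H" and tv: "t \<noteq> v"
    using c_in_H_iff[of n] c_in_H_iff[of 0] n by (auto simp: t_def v_def)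
  have V: "insert t H \<union> c ` {1..<n} = V"
    using H_union unfolding range by (auto simp: t_def)
  have "frank V V M = frank V V (\<lambda>u w. B2 u w + (\<Sum>i<n. edge_mat (c i) (c (i + 1)) (wt i) u w))"
  proof (rule frank_cong)
    fix u w assume uw: "u \<in> V" "w \<in> V"
    show "M u w = B2 u w + (\<Sum>i<n. edge_mat (c i) (c (i + 1)) (wt i) u w)"
      using matrix_decomposition[OF uw] cn unfolding range by (simp add: B2_def t_def v_def)
  qed
  also have "\<dots> = frank (insert t H) (insert t H) N + 2 * m"
    unfolding N_def q_def v_def t_def
  proof (rule frank_contract_ear[of "insert t H" c m wt B2, folded n_def, unfolded V, unfolded t_def])
    show "inj_on c {1..<n}" using inj n by (auto simp: inj_on_def)
    show "c ` {1..<n} \<inter> insert (c n) H = {}"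
    proof -
      have "c n \<notin> c ` {1..<n}" using c_eq_iff n by fastforce
      then show ?thesis unfolding H_def range by auto
    qed
    show "B2 u w = 0" if "u \<notin> insert (c n) H \<or> w \<notin> insert (c n) H" for u w
    proof -
      have "u \<noteq> t \<and> u \<noteq> v \<and> u \<notin> H \<or> w \<noteq> t \<and> w \<noteq> v \<and> w \<notin> H"
        using that vH unfolding t_def by blast
      then show ?thesis by (elim disjE) (simp_all add: B2_def B_def edge_mat_outside)
    qed
  qed (use finite_parts vH n wt_nonzero in \<open>auto simp: v_def\<close>)
  finally have red: "frank V V M = frank (insert t H) (insert t H) N + 2 * m" .
  have NH: "N u w = M u w" if "u \<in> H" "w \<in> H" for u w
  proof -
    have "u \<noteq> t" "w \<noteq> t" using that tH by auto
    then show ?thesis using that by (simp add: N_def B2_def B_def edge_mat_def)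
  qed
  let ?a = "wt n"
  have a0: "?a \<noteq> 0" using wt_nonzero n by simp
  have q0: "q \<noteq> 0" using wt_nonzero n by (auto simp: q_def)
  have Ntv: "N t v = ?a + 1 / q" and Nvt: "N v t = 1 / ?a + q"
    using tv tH by (simp_all add: N_def B2_def B_def edge_mat_def)
  have Nt: "N t w = 0" "N w t = 0" if "w \<in> insert t H" "w \<noteq> v" for w
    using that tH tv by (simp_all add: N_def B2_def B_def edge_mat_def)
  let ?g = "\<Prod>i<p. M (c i) (c (i + 1))"
  have sq: "(-1) ^ m * (-1) ^ m = (1 :: 'k)" by (simp flip: power_mult_distrib)
  have qa: "q * ?a = (-1) ^ m * ?g" unfolding range by (simp add: q_def wt_def mult.assoc mult.commute)
  \<comment> \<open>The \<open>m\<close> contractions contribute the sign \<open>(-1) ^ m\<close>,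
    which is its own inverse, so the critical gain corresponds to
    \<open>q * ?a = - 1\<close>.\<close>
  have crit: "?g = (-1) ^ (m + 1) \<longleftrightarrow> q * ?a = - 1"
  proof
    assume "?g = (-1) ^ (m + 1)"
    then show "q * ?a = - 1" unfolding qa using sq by simp
  next
    assume "q * ?a = - 1"
    then have "(-1) ^ m * ((-1) ^ m * ?g) = (-1) ^ m * - 1" unfolding qa by simp
    then have "((-1) ^ m * (-1) ^ m) * ?g = - ((-1) ^ m)" by (simp only: mult.assoc) simp
    then show "?g = (-1) ^ (m + 1)" unfolding sq by simp
  qed
  \<comment> \<open>Up to nonzero factors both directed entries equal \<open>q * ?a + 1\<close>, so
    they vanish together.\<close>
  have N1: "q * N t v = q * ?a + 1" and N2: "?a * N v t = q * ?a + 1"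
    using a0 q0 by (simp_all add: Ntv Nvt distrib_left mult.commute)
  show ?thesis
  proof (cases "?g = (-1) ^ (m + 1)")
    case True
    then have "N t v = 0" "N v t = 0" using crit N1 N2 a0 q0 by auto
    then have "frank (insert t H) (insert t H) N = frank H H N"
      by (intro frank_insert_zero finite_parts) (use Nt in metis)+
    also have "\<dots> = frank H H M" by (rule frank_cong) (use NH in auto)
    finally show ?thesis using red True by simp
  next
    case False
    then have "q * ?a + 1 \<noteq> 0" using crit eq_neg_iff_add_eq_0[of "q * ?a" 1] by simp
    then have nz: "N t v \<noteq> 0" "N v t \<noteq> 0" using N1 N2 by auto
    have "frank (insert t (insert v F)) (insert t (insert v F)) N =
      frank F F (\<lambda>u w. N u w - N u v * N t w / N t v - N u t * N v w / N v t) + 2"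
      by (rule frank_eliminate_pair) (use nz finite_parts Nt[of t] tv NH[of v v] vH loop in \<open>auto simp: v_def\<close>)
    \<comment> \<open>\<open>t\<close> is joined to \<open>v\<close> alone, so on \<open>F\<close>
      each correction term has a zero factor.\<close>
    also have "frank F F (\<lambda>u w. N u w - N u v * N t w / N t v - N u t * N v w / N v t) = frank F F M"
    proof (rule frank_cong)
      fix u w assume "u \<in> F" "w \<in> F"
      then have "N t w = 0" "N u t = 0" "N u w = M u w"
        using Nt[of w] Nt[of u] NH[of u w] cF H_eq by (auto simp: v_def)
      then show "N u w - N u v * N t w / N t v - N u t * N v w / N v t = M u w" by simp
    qed
    finally show ?thesis using red False H_eq by (simp add: v_def)
  qed
qed

end

section \<open>Graphs with a cycle attached at one vertex\<close>

locale ear_cycle_graph = ear_cycle V c p for V :: "'a set" and c p +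
  fixes E :: "'a \<Rightarrow> 'a \<Rightarrow> bool"
  assumes sym: "\<And>x y. E x y \<Longrightarrow> E y x" and irrefl: "\<And>x. \<not> E x x"
    and cycle_edge: "\<And>i. i < p \<Longrightarrow> E (c i) (c (i + 1))"
    and cycle_nbrs: "\<And>j w. 1 \<le> j \<Longrightarrow> j < p \<Longrightarrow> w \<in> V \<Longrightarrow> E (c j) w \<Longrightarrow> w = c (j + 1) \<or> w = c (j - 1)"
begin

text \<open>Serves the gains and, with constant weight 1, the underlying graph, so that both ranks
  follow from the same elimination.\<close>

lemma ear_cycle_matrix:
  assumes "\<And>i. i < p \<Longrightarrow> phi (c i) (c (i + 1)) * phi (c (i + 1)) (c i) = (1 :: 'k::field)"
  shows "ear_cycle_matrix V c p (\<lambda>x y. if E x y then phi x y else 0)"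
proof unfold_locales
  fix i assume "i < p"
  then show "(if E (c i) (c (i + 1)) then phi (c i) (c (i + 1)) else 0) *
    (if E (c (i + 1)) (c i) then phi (c (i + 1)) (c i) else 0) = 1"
    using assms cycle_edge[of i] sym[of "c i" "c (i + 1)"] by simp
next
  fix j w assume "1 \<le> j" "j < p" "w \<in> V" "w \<noteq> c (j + 1)" "w \<noteq> c (j - 1)"
  then have "\<not> E (c j) w" using cycle_nbrs by blast
  then show "(if E (c j) w then phi (c j) w else 0) = 0 \<and> (if E w (c j) then phi w (c j) else 0) = 0"
    using sym[of w "c j"] by auto
qed

text \<open>Collapsing the cycle to \<open>c 0\<close> retracts the graph onto \<open>H\<close>;
  \<open>p\<close> edges but only \<open>p - 1\<close> vertices disappear.\<close>

lemma cyclomatic_H: "cyclomatic H E + 1 \<le> cyclomatic V E"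
proof -
  define L where "L = (\<lambda>i. {c i, c (i + 1)}) ` {..<p}"
  have "inj_on (\<lambda>i. {c i, c (i + 1)}) {..<p}"
  proof (rule linorder_inj_onI')
    fix i j assume ij: "i \<in> {..<p}" "j \<in> {..<p}" "i < j"
    have "c i \<noteq> c j" using ij c_eq_iff by auto
    \<comment> \<open>Two consecutive edges could coincide only in a cycle of length 2.\<close>
    moreover have "c i \<noteq> c (j + 1)" if "c (i + 1) = c j"
    proof -
      have "j = i + 1" using that c_Suc_eq_iff[of i j] ij by auto
      then show ?thesis using c_Suc_neq_pred[of j] ij by (metis add_diff_cancel_right' le_add2 lessThan_iff)
    qed
    ultimately show "{c i, c (i + 1)} \<noteq> {c j, c (j + 1)}" by (auto simp: doubleton_eq_iff)
  qed
  then have cardL: "card L = p" by (simp add: L_def card_image)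
  have "V - H = c ` {1..<p}" using cV by (auto simp: H_def)
  moreover have "inj_on c {1..<p}" using inj by (auto simp: inj_on_def)
  ultimately have cardVH: "card (V - H) = p - 1" by (simp add: card_image)
  have nbr: "y \<in> c ` {..p}" if "x \<in> V - H" "y \<in> V" "E x y" for x y
    using that cycle_nbrs unfolding H_def by fastforce
  have on_cycle: "c i = c 0" if "i \<le> p" "c i \<in> H" for i
    using c_in_H_iff[of i] that closed by auto
  have "cyclomatic H E + int (card L) - int (card (V - H)) \<le> cyclomatic V E"
  proof (rule cyclomatic_retract[OF finV sym, where f = "\<lambda>x. if x \<in> H then x else c 0"])
    fix x y assume xy: "x \<in> V" "y \<in> V" "E x y"
    show "(if x \<in> H then x else c 0) = (if y \<in> H then y else c 0) \<or>
      E (if x \<in> H then x else c 0) (if y \<in> H then y else c 0)"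
    \<comment> \<open>An edge with an end outside \<open>H\<close> joins two cycle vertices, so both
      ends collapse to \<open>c 0\<close>.\<close>
    proof (cases "x \<in> H \<and> y \<in> H")
      case False
      then consider "x \<notin> H" | "y \<notin> H" by blast
      then have "(if x \<in> H then x else c 0) = c 0 \<and> (if y \<in> H then y else c 0) = c 0"
      proof cases
        case 1
        then obtain i where "y = c i" "i \<le> p" using nbr[of x y] xy by auto
        then show ?thesis using 1 on_cycle[of i] by simp
      next
        case 2
        then obtain i where "x = c i" "i \<le> p" using nbr[of y x] xy sym by auto
        then show ?thesis using 2 on_cycle[of i] by simp
      qed
      then show ?thesis by simp
    qed (use xy in simp)
  next
    show "L \<subseteq> edges V E" using cV cycle_edge unfolding L_def edges_def by fastforce
    have "\<not> {c i, c (i + 1)} \<subseteq> H" if "i < p" for i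
      using c_in_H_iff[of i] c_in_H_iff[of "i + 1"] that p3 by auto
    then have "L \<inter> Pow H = {}" by (auto simp: L_def)
    moreover have "edges H E \<subseteq> Pow H" by (auto simp: edges_def)
    ultimately show "L \<inter> edges H E = {}" by blast
  qed (use c_in_H_iff[of 0] in \<open>auto simp: H_def\<close>)
  then show ?thesis using cardL cardVH p3 by simp
qed

text \<open>In \<open>H\<close> the vertex \<open>c 0\<close> is pendant at \<open>z\<close>;
  folding it onto \<open>z\<close> removes one vertex and one edge.\<close>

lemma cyclomatic_F:
  assumes "z \<in> F" "E (c 0) z" and "\<And>y. y \<in> F \<Longrightarrow> E (c 0) y \<Longrightarrow> y = z"
  shows "cyclomatic F E \<le> cyclomatic H E"
proof -
  have "cyclomatic F E + int (card {{c 0, z}}) - int (card (H - F)) \<le> cyclomatic H E"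
  proof (rule cyclomatic_retract[OF finite_parts(1) sym, where f = "\<lambda>x. if x = c 0 then z else x"])
    fix x y assume xy: "x \<in> H" "y \<in> H" "E x y"
    show "(if x = c 0 then z else x) = (if y = c 0 then z else y) \<or>
      E (if x = c 0 then z else x) (if y = c 0 then z else y)"
      using xy assms(3)[of x] assms(3)[of y] sym[of x y] H_eq by auto
  next
    show "{{c 0, z}} \<inter> edges F E = {}" using cF by (auto simp: edges_def doubleton_eq_iff)
  qed (use assms(1,2) cF H_eq in \<open>auto simp: edges_def\<close>)
  moreover have "H - F = {c 0}" using H_eq cF by auto
  ultimately show ?thesis by simp
qed

end

section \<open>Ranks of gain graphs and the general upper bound\<close>

lemma gain_rank_eq_frank:
  "finite V \<Longrightarrow> gain_rank V E phi = frank V V (\<lambda>x y. if E x y then phi x y else 0)"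
  using rank_sorted_eq_frank[of V "\<lambda>x y. if E x y then phi x y else 0"]
  by (simp add: gain_rank_def gain_adj_def Let_def)

lemma graph_rank_eq_frank:
  "finite V \<Longrightarrow> graph_rank V E = frank V V (\<lambda>x y. if E x y then 1 else (0 :: real))"
  using rank_sorted_eq_frank[of V "\<lambda>x y. if E x y then 1 else (0 :: real)"]
  by (simp add: graph_rank_def adj_def Let_def)

lemma frank_of_real_le:
  fixes A :: "'a \<Rightarrow> 'b \<Rightarrow> real"
  assumes "finite R"
  shows "frank R C (\<lambda>x y. complex_of_real (A x y)) \<le> frank R C A"
proof -
  define k where "k = frank R C A"
  obtain b c where bc: "\<And>x y. x \<in> R \<Longrightarrow> y \<in> C \<Longrightarrow> A x y = (\<Sum>i<k. b i x * c i y)"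
    using factors_through_frank[OF assms, of C A] unfolding factors_through_def k_def by blast
  have "factors_through k R C (\<lambda>x y. complex_of_real (A x y))"
    unfolding factors_through_def
    by (intro exI[of _ "\<lambda>i x. complex_of_real (b i x)"] exI[of _ "\<lambda>i y. complex_of_real (c i y)"])
      (simp add: bc)
  then show ?thesis unfolding k_def by (rule frank_le)
qed

lemma unit_gain_inverse:
  assumes "unit_gain V E phi" "x \<in> V" "y \<in> V" "E x y"
  shows "phi x y * phi y x = 1"
  using assms by (auto simp: unit_gain_def complex_norm_square[symmetric])

theorem gain_rank_le:
  assumes "gain_graph V E phi"
  shows "int (gain_rank V E phi) \<le> int (graph_rank V E) + 2 * cyclomatic V E"
proof -
  have fin: "finite V" and sym: "\<And>x y. E x y \<Longrightarrow> E y x" and irr: "\<And>x. \<not> E x x"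
    and unit: "unit_gain V E phi"
    using assms by (auto simp: gain_graph_def simple_graph_def)
  let ?A = "\<lambda>x y. if E x y then phi x y else 0"
  let ?R = "\<lambda>x y. complex_of_real (if E x y then 1 else 0)"
  have "\<exists>d K. (\<forall>x. d x \<noteq> 0) \<and> K \<subseteq> edges V E \<and> int (card K) \<le> cyclomatic V E \<and>
      (\<forall>x\<in>V. \<forall>y\<in>V. E x y \<longrightarrow> {x, y} \<notin> K \<longrightarrow> d x * phi x y = d y)"
    by (rule switching_exists[OF fin sym irr unit_gain_inverse[OF unit]])
  then obtain d K where d: "\<And>x. d x \<noteq> 0" and K: "K \<subseteq> edges V E" "int (card K) \<le> cyclomatic V E"
    and good: "\<And>x y. x \<in> V \<Longrightarrow> y \<in> V \<Longrightarrow> E x y \<Longrightarrow> {x, y} \<notin> K \<Longrightarrow> d x * phi x y = d y"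
    by blast
  \<comment> \<open>Undoing the switching is a scaling of rows and columns. Outside \<open>K\<close>
    the switched entries are those of the 0-1 adjacency matrix.\<close>
  have "frank V V ?A \<le> frank V V (\<lambda>x y. d x * ?A x y / d y)"
    by (rule frank_transfer[OF fin, where f = "\<lambda>x. x" and g = "\<lambda>x. x" and u = "\<lambda>x. 1 / d x" and w = d])
      (use d in auto)
  also have "\<dots> \<le> frank V V ?R + 2 * card K"
  proof (rule frank_change_pairs)
    show "finite K" using K(1) finite_edges[OF fin] finite_subset by blast
    show "\<exists>x y. e = {x, y}" if "e \<in> K" for e
      using subsetD[OF K(1) that] by (auto simp: edges_def)
    show "{x, y} \<in> K" if "x \<in> V" "y \<in> V" "d x * ?A x y / d y \<noteq> ?R x y" for x y
      using that good[of x y] d[of y] by (auto split: if_splits)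
  qed (rule fin)
  also have "frank V V ?R \<le> graph_rank V E"
    unfolding graph_rank_eq_frank[OF fin] by (rule frank_of_real_le[OF fin])
  finally show ?thesis using K(2) unfolding gain_rank_eq_frank[OF fin] by linarith
qed

section \<open>From pendant cycles to closed enumerations\<close>

lemma inj_on_add_mod: "inj_on (\<lambda>i. (k + i) mod p) {..<p}" for k p :: nat
proof (rule linorder_inj_onI')
  fix i j assume ij: "i \<in> {..<p}" "j \<in> {..<p}" "i < j"
  show "(k + i) mod p \<noteq> (k + j) mod p"
  proof
    assume "(k + i) mod p = (k + j) mod p"
    then have "p dvd (k + j) - (k + i)" using ij mod_eq_dvd_iff_nat[of "k + i" "k + j" p] by simp
    then show False using ij nat_dvd_not_less[of "j - i" p] by (simp add: less_imp_diff_less)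
  qed
qed

lemma bij_betw_add_mod: "bij_betw (\<lambda>i. (k + i) mod p) {..<p} {..<p}" for k p :: nat
proof -
  have "(\<lambda>i. (k + i) mod p) ` {..<p} \<subseteq> {..<p}" by auto
  then show ?thesis
    using endo_inj_surj[OF _ _ inj_on_add_mod[of k p]] inj_on_add_mod[of k p] by (simp add: bij_betw_def)
qed

text \<open>\<open>c\<close> is the list rotated to start at \<open>v\<close>, which only reorders
  the factors of the gain. An inner vertex has degree 2 and two distinct neighbours on the cycle,
  hence no others.\<close>

lemma pendant_cycle_enumeration:
  assumes graph: "simple_graph V E" and pendant: "pendant_cycle V E cs v"
  obtains c where "ear_cycle_graph V c (length cs) E" and "c 0 = v" and "c ` {..<length cs} = set cs"
    and "\<And>phi. (\<Prod>i<length cs. phi (c i) (c (i + 1))) = cycle_gain phi cs"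
proof -
  define p where "p = length cs"
  have cyc: "distinct cs" "p \<ge> 3" "set cs \<subseteq> V"
    and adj: "\<And>i j. i < p \<Longrightarrow> j < p \<Longrightarrow> E (cs ! i) (cs ! j) \<longleftrightarrow> j = (i + 1) mod p \<or> i = (j + 1) mod p"
    and v: "v \<in> set cs" and deg: "\<And>u. u \<in> set cs \<Longrightarrow> u \<noteq> v \<Longrightarrow> degree V E u = 2"
    using pendant by (auto simp: pendant_cycle_def induced_cycle_def p_def)
  obtain k where k: "k < p" "cs ! k = v" using v by (auto simp: in_set_conv_nth p_def)
  define c where "c i = cs ! ((k + i) mod p)" for i
  have c0: "c 0 = v" "c p = v" using k by (simp_all add: c_def)
  have nth: "bij_betw ((!) cs) {..<p} (set cs)" using cyc(1) by (simp add: bij_betw_nth p_def)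
  have bij: "bij_betw c {..<p} (set cs)"
    using bij_betw_trans[OF bij_betw_add_mod[of k p] nth] by (simp add: c_def[abs_def] comp_def)
  interpret ear_cycle V c p
    by unfold_locales
      (use graph cyc c0 bij in \<open>auto simp: simple_graph_def bij_betw_def\<close>)
  have Suc: "c (i + 1) = cs ! (((k + i) mod p + 1) mod p)" for i
    by (simp add: c_def mod_simps)
  have edge: "E (c i) (c (i + 1))" for i
    unfolding Suc unfolding c_def using adj[of "(k + i) mod p" "((k + i) mod p + 1) mod p"] cyc(2) by simp
  have "ear_cycle_graph V c p E"
  proof unfold_locales
    show Esym: "E x y \<Longrightarrow> E y x" for x y using graph by (auto simp: simple_graph_def)
    show "\<not> E x x" for x using graph by (auto simp: simple_graph_def)
    show "E (c i) (c (i + 1))" for i by (rule edge)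
    fix j w assume j: "1 \<le> j" "j < p" and w: "w \<in> V" "E (c j) w"
    let ?N = "{u \<in> V. E (c j) u}"
    have "c j \<in> set cs" using bij j by (auto simp: bij_betw_def)
    moreover have "c j \<noteq> v" using c_eq_iff[of j 0] j c0 by simp
    ultimately have "card ?N = 2" using deg by (simp add: degree_def)
    moreover have "{c (j + 1), c (j - 1)} \<subseteq> ?N"
      using edge[of j] Esym[OF edge[of "j - 1"]] j cV[of "j + 1"] cV[of "j - 1"] by simp
    moreover have "card {c (j + 1), c (j - 1)} = 2" using c_Suc_neq_pred[OF j] by simp
    ultimately have "{c (j + 1), c (j - 1)} = ?N" using finV by (intro card_subset_eq) auto
    then show "w = c (j + 1) \<or> w = c (j - 1)" using w by auto
  qed
  moreover have "(\<Prod>i<p. phi (c i) (c (i + 1))) = cycle_gain phi cs" for phi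
    using prod.reindex_bij_betw[OF bij_betw_add_mod[of k p], of "\<lambda>i. phi (cs ! i) (cs ! ((i + 1) mod p))"]
    unfolding cycle_gain_def p_def[symmetric] Suc by (simp add: c_def)
  ultimately show ?thesis using that[of c] c0 bij unfolding p_def by (auto simp: bij_betw_def)
qed

text \<open>\<open>c 1\<close> and \<open>c (p - 1)\<close> are two of the three neighbours of
  \<open>c 0\<close>. A neighbour on the cycle is an inner vertex next to \<open>c 0\<close>, hence
  one of these two, so the third lies in \<open>F\<close>.\<close>

lemma (in ear_cycle_graph) attachment_vertex:
  assumes "degree V E (c 0) = 3"
  obtains z where "z \<in> F" "E (c 0) z" "\<And>y. y \<in> F \<Longrightarrow> E (c 0) y \<Longrightarrow> y = z"
proof -
  let ?N = "{u \<in> V. E (c 0) u}" and ?T = "{c 1, c (p - 1)}"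
  have "c 1 \<noteq> c (p - 1)" using c_eq_iff[of 1 "p - 1"] p3 by simp
  then have T: "card ?T = 2" by simp
  have "E (c 0) (c 1)" using cycle_edge[of 0] p3 by simp
  moreover have "E (c 0) (c (p - 1))"
    using sym[OF cycle_edge[of "p - 1"]] p3 closed by simp
  ultimately have TN: "?T \<subseteq> ?N" using cV[of 1] cV[of "p - 1"] p3 by simp
  have N: "?N - ?T = {u \<in> F. E (c 0) u}"
  proof -
    have "u \<in> ?T" if u: "E (c 0) u" "u \<in> c ` {..<p}" for u
    proof -
      obtain j where j: "j < p" "u = c j" using u(2) by blast
      have "j \<noteq> 0" using irrefl[of "c 0"] u(1) j by (intro notI) simp
      then have "c 0 = c (j + 1) \<or> c 0 = c (j - 1)"
        using cycle_nbrs[of j "c 0"] sym[OF u(1)] j cV[of 0] by simp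
      then have "j + 1 = p \<or> j = 1"
        using c_eq_iff[of 0 "j + 1"] c_eq_iff[of 0 "j - 1"] j \<open>j \<noteq> 0\<close> by (cases "j + 1 = p") auto
      then show ?thesis using j by auto
    qed
    moreover have "?T \<subseteq> c ` {..<p}" using p3 by auto
    ultimately show ?thesis unfolding F_def by blast
  qed
  have "card (?N - ?T) = 3 - 2"
    using card_Diff_subset[of ?T ?N] TN T assms by (simp add: degree_def)
  then obtain z where "{u \<in> F. E (c 0) u} = {z}" unfolding N by (auto simp: card_1_singleton_iff)
  then show ?thesis using that[of z] by blast
qed

text \<open>For odd cycles, where \<open>H\<close> acquires an unknown diagonal entry at
  \<open>c 0\<close>: the block on \<open>F\<close> does not see that entry, so its rank serves as
  the reference.\<close>

lemma (in ear_cycle) frank_corner_bounds: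
  fixes M :: "'a \<Rightarrow> 'a \<Rightarrow> 'k::field"
  defines "Mc \<equiv> \<lambda>e u w. M u w + (if u = c 0 \<and> w = c 0 then e else 0)"
  shows "frank F F M \<le> frank H H (Mc e)" and "frank H H (Mc e) \<le> frank F F M + 2"
    and "frank H H M \<le> frank H H (Mc e) + 1"
    and "frank H H (Mc e) = frank F F M + 2 \<Longrightarrow> frank H H M = frank F F M + 2"
proof -
  have F: "frank F F (Mc e) = frank F F M"
    by (rule frank_cong) (use cF in \<open>auto simp: Mc_def\<close>)
  show "frank F F M \<le> frank H H (Mc e)"
    unfolding F[symmetric] by (rule frank_mono) (use finite_parts H_eq in auto)
  show "frank H H (Mc e) \<le> frank F F M + 2"
    unfolding F[symmetric] H_eq by (rule frank_insert_both[OF finite_parts(2)])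
  show "frank H H M \<le> frank H H (Mc e) + 1"
    unfolding Suc_eq_plus1[symmetric]
    by (rule frank_upd_entry[OF finite_parts(1), where a = "c 0" and b = "c 0"]) (auto simp: Mc_def)
  assume "frank H H (Mc e) = frank F F M + 2"
  then show "frank H H M = frank F F M + 2"
    unfolding F[symmetric] H_eq
    by (rule frank_corner_independent[OF finite_parts(2) cF cF, of "Mc e"]) (auto simp: Mc_def)
qed

section \<open>Equality in the upper bound at a pendant cycle\<close>

theorem theorem4p5:
  fixes V :: "'a::linorder set" and E :: "'a \<Rightarrow> 'a \<Rightarrow> bool"
    and phi :: "'a \<Rightarrow> 'a \<Rightarrow> complex" and cs :: "'a list" and v :: 'a
  assumes "gain_graph V E phi"
    and "pendant_cycle V E cs v"
    and "int (gain_rank V E phi) = int (graph_rank V E) + 2 * cyclomatic V E"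
  defines "p \<equiv> length cs"
    and "F \<equiv> V - set cs"
    and "H \<equiv> insert v (V - set cs)"
  shows "(type_B phi cs \<and> p mod 4 = 0)
     \<and> (int (gain_rank H E phi) = int (graph_rank H E) + 2 * cyclomatic H E
        \<and> int (gain_rank F E phi) = int (graph_rank F E) + 2 * cyclomatic F E)
     \<and> (gain_rank V E phi = p + gain_rank F E phi
        \<and> gain_rank F E phi = gain_rank H E phi
        \<and> graph_rank V E = p - 2 + graph_rank H E
        \<and> graph_rank F E = graph_rank H E)"
proof -
  have graph: "simple_graph V E" and unit: "unit_gain V E phi"
    using assms(1) by (auto simp: gain_graph_def)
  obtain c where c: "ear_cycle_graph V c p E" "c 0 = v" "c ` {..<p} = set cs"
    and gain: "\<And>psi :: 'a \<Rightarrow> 'a \<Rightarrow> complex. (\<Prod>i<p. psi (c i) (c (i + 1))) = cycle_gain psi cs"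
    using pendant_cycle_enumeration[OF graph assms(2)] unfolding p_def by blast
  interpret ear: ear_cycle_graph V c p E by (rule c(1))
  have F: "F = ear.F" and H: "H = ear.H"
    unfolding F_def H_def ear.H_eq ear.F_def c(2,3) by auto
  have fin: "finite V" "finite F" "finite H"
    using ear.finV ear.finite_parts by (auto simp: F H)
  have sub: "F \<subseteq> H" "H \<subseteq> V" using ear.H_eq ear.H_def by (auto simp: F H)
  obtain z where z: "z \<in> ear.F" "E (c 0) z" "\<And>y. y \<in> ear.F \<Longrightarrow> E (c 0) y \<Longrightarrow> y = z"
    using ear.attachment_vertex assms(2) c(2) unfolding pendant_cycle_def by metis
  have thetaF: "cyclomatic F E \<le> cyclomatic H E" using ear.cyclomatic_F[OF z] by (simp add: F H)
  have thetaH: "cyclomatic H E + 1 \<le> cyclomatic V E" using ear.cyclomatic_H by (simp add: H)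
  define A where "A x y = (if E x y then phi x y else 0)" for x y
  define R :: "'a \<Rightarrow> 'a \<Rightarrow> real" where "R x y = (if E x y then 1 else 0)" for x y
  have rk: "gain_rank S E phi = frank S S A" "graph_rank S E = frank S S R" if "finite S" for S
    unfolding A_def[abs_def] R_def[abs_def] using gain_rank_eq_frank graph_rank_eq_frank that by blast+
  have bound: "int (frank S S A) \<le> int (frank S S R) + 2 * cyclomatic S E" if "S \<subseteq> V" for S
  proof -
    have "finite S" using that fin(1) finite_subset by blast
    moreover have "gain_graph S E phi"
      using graph unit that calculation
      unfolding gain_graph_def simple_graph_def unit_gain_def by blast
    ultimately show ?thesis using gain_rank_le rk by metis
  qed
  note boundF = bound[OF order_trans[OF sub]] and boundH = bound[OF sub(2)]
  have monoA: "frank F F A \<le> frank H H A" and monoR: "frank F F R \<le> frank H H R"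
    using frank_mono[OF fin(3) sub(1) sub(1)] by blast+
  have stepA: "frank H H A \<le> frank F F A + 2"
    using frank_insert_both[OF fin(2), of v v F A] by (simp add: H_def F_def)
  have eq: "int (frank V V A) = int (frank V V R) + 2 * cyclomatic V E"
    using assms(3) rk fin(1) by simp
  interpret MA: ear_cycle_matrix V c p A
    unfolding A_def[abs_def]
    by (rule ear.ear_cycle_matrix) (use unit_gain_inverse[OF unit] ear.cV ear.cycle_edge in simp)
  interpret MR: ear_cycle_matrix V c p R
    unfolding R_def[abs_def] by (rule ear.ear_cycle_matrix) simp
  have "even p"
  proof (rule ccontr)
    assume "odd p"
    then obtain m where m: "p = 2 * m + 1" by (rule oddE)
    obtain e where e: "frank V V A =
        frank H H (\<lambda>u w. A u w + (if u = c 0 \<and> w = c 0 then e else 0)) + 2 * m"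
      using MA.frank_odd_cycle[OF m] unfolding H by blast
    obtain e' where e': "frank V V R =
        frank H H (\<lambda>u w. R u w + (if u = c 0 \<and> w = c 0 then e' else 0)) + 2 * m"
      using MR.frank_odd_cycle[OF m] unfolding H by blast
    note cornA = ear.frank_corner_bounds[of A e, folded F H]
    note cornR = ear.frank_corner_bounds[of R e', folded F H]
    \<comment> \<open>Equality for the whole graph and the bound for \<open>F\<close> push the
      modified \<open>H\<close> to the largest possible rank, two above \<open>F\<close>.\<close>
    have "frank H H (\<lambda>u w. A u w + (if u = c 0 \<and> w = c 0 then e else 0)) = frank F F A + 2"
      using e e' eq cornA(2) cornR(1) boundF thetaF thetaH by linarith
    \<comment> \<open>So the unmodified \<open>H\<close> also gains two. But \<open>boundH\<close>
      allows a gain of at most one: resetting the real diagonal entry raises the rank by at most 1,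
      while passing from \<open>V\<close> to \<open>H\<close> costs at least 2 through the
      cyclomatic number.\<close>
    then have "frank H H A = frank F F A + 2" by (rule cornA(4))
    then show False
      using e e' eq cornA(2) cornR(1,3) boundF boundH thetaF thetaH by linarith
  qed
  then have "p = 2 * (p div 2 - 1) + 2" using ear.p3 by (auto elim!: evenE)
  then obtain m where m: "p = 2 * m + 2" by blast
  have loops: "A (c 0) (c 0) = 0" "R (c 0) (c 0) = 0" using ear.irrefl by (auto simp: A_def R_def)
  have "(\<Prod>i<p. A (c i) (c (i + 1))) = cycle_gain phi cs"
    unfolding gain[symmetric] by (rule prod.cong) (use ear.cycle_edge in \<open>auto simp: A_def\<close>)
  then have rankA: "frank V V A = (if type_B phi cs then frank F F A + 2 * m + 2 else frank H H A + 2 * m)"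
    using MA.frank_even_cycle[OF m loops(1)] m by (simp add: type_B_def F H p_def)
  have "(\<Prod>i<p. R (c i) (c (i + 1))) = 1"
    by (rule prod.neutral) (use ear.cycle_edge in \<open>auto simp: R_def\<close>)
  \<comment> \<open>The gain 1 equals \<open>(-1) ^ (m + 1)\<close> exactly for odd
    \<open>m\<close>.\<close>
  then have rankR: "frank V V R = (if odd m then frank H H R + 2 * m else frank F F R + 2 * m + 2)"
    using MR.frank_even_cycle[OF m loops(2)] by (simp add: F H minus_one_power_iff)
  \<comment> \<open>Not Type B with odd \<open>m\<close> violates \<open>boundH\<close>; Type B with
    even \<open>m\<close> violates \<open>boundF\<close>; not Type B with even \<open>m\<close>
    would put \<open>H\<close> at least four above \<open>F\<close>, against
    \<open>stepA\<close>.\<close>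
  have B: "type_B phi cs" and odd: "odd m"
    using rankA rankR eq boundF boundH monoA monoR stepA thetaF thetaH by (auto split: if_splits)
  have "p mod 4 = 0" using m odd by presburger
  moreover have rV: "frank V V A = frank F F A + 2 * m + 2" "frank V V R = frank H H R + 2 * m"
    using rankA rankR B odd by simp_all
  \<comment> \<open>By \<open>eq\<close>, \<open>frank F F A + 2\<close> equals
    \<open>frank H H R + 2 * cyclomatic V E\<close>, which is at least
    \<open>frank H H R + 2 * cyclomatic H E + 2\<close>. The bounds and monotonicity close this into
    a cycle of inequalities through \<open>H\<close> and through \<open>F\<close>, so all are
    equalities.\<close>
  ultimately show ?thesis
    unfolding rk[OF fin(1)] rk[OF fin(2)] rk[OF fin(3)]
    using B m eq boundF boundH monoA monoR thetaF thetaH by (intro conjI) linarith+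
qed

end
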